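(* Let $n\ge1$, let $\mathfrak p_0\in A=\mathbb F_q[T]$ be monic irreducible of degree $r$ with $\gcd(n,r)=1$, let $t\in\mathbb F_{q^r}$ be a root of $\mathfrak p_0$, let $\phi$ be the Drinfeld module with $\phi_T=t+\tau^n$, let $\mathfrak p\neq\mathfrak p_0$ be a monic irreducible element of $A$ of degree $d$, and let $m\mid n$. With the notation of the context, let $\alpha\in M=\phi[\mathfrak p]$ be $S$-normal, let $1\le\delta\le m$, and let $C=\operatorname{Ann}(W_\delta)\subseteq R$ be the rank-BCH code of designed distance $\delta$. Then $$\dim_{\mathbb F_q}C=nd\,(m-\delta+1),\qquad d_R(C)=\delta.$$ Thus the designed distance is the true distance.
   Context: $q$ is a prime power, $A=\mathbb F_q[T]$, $\overline{\mathbb F}_q$ a fixed algebraic closure, $[i]=q^i$, $\beta^{[i]}=\beta^{q^i}$. Twisted polynomials in $\tau$ satisfy $\tau a=a^q\tau$ and act on $\overline{\mathbb F}_q$ with $\tau$ acting as $x\mapsto x^q$ and constants by multiplication. $\phi\colon A\to\mathbb F_{q^r}\{\tau\}$, $a\mapsto\phi_a$, is the $\mathbb F_q$-algebra homomorphism with $\phi_T=t+\tau^n$. Put $\kappa=A/\mathfrak p\cong\mathbb F_{q^d}$ and $M=\phi[\mathfrak p]=\{v\in\overline{\mathbb F}_q:\phi_{\mathfrak p}(v)=0\}$, a $\kappa$-vector space of dimension $n$ via $a\cdot v=\phi_a(v)$; $E=\operatorname{End}_\kappa(M)$; $\pi=\tau^r$, acting on $M$ by $v\mapsto v^{[r]}$;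 $S=\kappa[\pi|_M]$; $R_0=\kappa[\pi^m|_M]$; $R=\operatorname{Cent}_E(R_0)$ (centralizer); $L=\mathbb F_{q^m}\subseteq R$ acting on $M$ by scalar multiplication. A code is a left ideal of $R$. For an $R_0$-submodule $W\subseteq M$, $\operatorname{Ann}(W)=\{f\in R: f(W)=0\}$. Rank weight: multiplication $L\otimes_{\mathbb F_q}S\to R$ is bijective, and $\dim_{\mathbb F_q}S=nd$. Fix an $\mathbb F_q$-basis $(s_j)_{1\le j\le nd}$ of $S$; every $f\in R$ is uniquely $f=\sum_jb_js_j$ with $b_j\in L$, and $\operatorname{wt}(f)=\dim_{\mathbb F_q}\langle b_1,\dots,b_{nd}\rangle_{\mathbb F_q}$ (independent of the basis). For a code $C\neq0$, $d_R(C)=\min\{\operatorname{wt}(f):0\ne f\in C\}$. $\alpha\in M$ is $S$-normal if $\alpha,\alpha^{[r]},\dots,\alpha^{[r(n-1)]}$ is a $\kappa$-basis of $M$; equivalently, the evaluation map $S\to M$, $x\mapsto x(\alpha)$, is bijective. For $S$-normal $\alpha$ and $1\le\delta\le m$, put $W_\delta=\bigoplus_{i=0}^{\delta-2}R_0\,\alpha^{[ri]}\subseteq M$ (the sum is direct; $W_1=0$); the rank-BCH code of designed distance $\delta$ is $\operatorname{Ann}(W_\delta)$. *)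

theory Defs
  imports
    "HOL-Algebra.Algebraic_Closure_Type"
    "HOL-Library.Function_Algebras"
    "HOL-Library.FuncSet"
    "HOL-Library.Cardinality"
begin

text \<open>
  The base field \<open>\<bbbF>\<^sub>q\<close> is an arbitrary type \<open>'q\<close> of sort \<open>{field, finite}\<close>, so \<open>q = CARD('q)\<close>;
  \<open>A = \<bbbF>\<^sub>q[T]\<close> is \<open>'q poly\<close>, and the algebraic closure is \<open>'q alg_closure\<close> with embedding \<open>to_ac\<close>.
\<close>

definition frob :: "nat \<Rightarrow> 'q::{field,finite} alg_closure \<Rightarrow> 'q alg_closure" where
  "frob i x = x ^ (CARD('q) ^ i)"

definition subfield_Fq :: "nat \<Rightarrow> 'q::{field,finite} alg_closure set" where
  "subfield_Fq k = {x. frob k x = x}"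

section \<open>Twisted polynomials and the Drinfeld module\<close>

text \<open>
  The twisted polynomial \<open>\<Sum> a\<^sub>i \<tau>\<^sup>i\<close> is represented by the ordinary polynomial with coefficients \<open>a\<^sub>i\<close>.
  Addition and \<open>\<bbbF>\<^sub>q\<close>-scaling are those of \<open>poly\<close>; multiplication is \<open>tw_mult\<close>, not the
  multiplication of \<open>poly\<close>, and the action on the closure is \<open>tw_apply\<close>, not \<open>poly\<close>.
\<close>

definition tw_mult ::
  "'q::{field,finite} alg_closure poly \<Rightarrow> 'q alg_closure poly \<Rightarrow> 'q alg_closure poly" where
  "tw_mult f g = (\<Sum>i\<le>degree f. \<Sum>j\<le>degree g. monom (coeff f i * frob i (coeff g j)) (i + j))"

definition tw_apply ::
  "'q::{field,finite} alg_closure poly \<Rightarrow> 'q alg_closure \<Rightarrow> 'q alg_closure" where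
  "tw_apply f v = (\<Sum>i\<le>degree f. coeff f i * frob i v)"

definition tw_algebra_hom ::
  "nat \<Rightarrow> ('q::{field,finite} poly \<Rightarrow> 'q alg_closure poly) \<Rightarrow> bool" where
  "tw_algebra_hom r \<phi> \<longleftrightarrow>
     (\<forall>a i. coeff (\<phi> a) i \<in> subfield_Fq r) \<and>
     \<phi> 1 = 1 \<and>
     (\<forall>a b. \<phi> (a + b) = \<phi> a + \<phi> b) \<and>
     (\<forall>a b. \<phi> (a * b) = tw_mult (\<phi> a) (\<phi> b)) \<and>
     (\<forall>c a. \<phi> (smult c a) = smult (to_ac c) (\<phi> a))"

definition torsion ::
  "('q::{field,finite} poly \<Rightarrow> 'q alg_closure poly) \<Rightarrow> 'q poly \<Rightarrow> 'q alg_closure set" where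
  "torsion \<phi> p = {v. tw_apply (\<phi> p) v = 0}"

section \<open>The residue field and its action on the torsion\<close>

definition kappa :: "'q::{field,finite} poly \<Rightarrow> 'q poly set set" where
  "kappa p = UNIV // {(a, b). p dvd a - b}"

text \<open>On \<open>torsion \<phi> p\<close> the value does not depend on the representative chosen from \<open>c \<in> kappa p\<close>.\<close>

definition kappa_act ::
  "('q::{field,finite} poly \<Rightarrow> 'q alg_closure poly) \<Rightarrow> 'q poly set \<Rightarrow>
   'q alg_closure \<Rightarrow> 'q alg_closure" where
  "kappa_act \<phi> c v = tw_apply (\<phi> (SOME a. a \<in> c)) v"

section \<open>Endomorphism rings\<close>

text \<open>
  An endomorphism of \<open>M = torsion \<phi> p\<close> is represented by its extension by \<open>0\<close> to the whole
  algebraic closure. Equality of endomorphisms is then equality of functions, the ring product is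
  composition, and the zero endomorphism is the zero function. Multiplication by \<open>*\<close> on function
  types is pointwise and is never the ring product.
\<close>

definition End_kappa ::
  "('q::{field,finite} poly \<Rightarrow> 'q alg_closure poly) \<Rightarrow> 'q poly \<Rightarrow>
   ('q alg_closure \<Rightarrow> 'q alg_closure) set" where
  "End_kappa \<phi> p = {f.
     (\<forall>v. v \<notin> torsion \<phi> p \<longrightarrow> f v = 0) \<and>
     (\<forall>v\<in>torsion \<phi> p. f v \<in> torsion \<phi> p) \<and>
     (\<forall>v\<in>torsion \<phi> p. \<forall>w\<in>torsion \<phi> p. f (v + w) = f v + f w) \<and>
     (\<forall>c\<in>kappa p. \<forall>v\<in>torsion \<phi> p. f (kappa_act \<phi> c v) = kappa_act \<phi> c (f v))}"

definition frob_end ::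
  "('q::{field,finite} poly \<Rightarrow> 'q alg_closure poly) \<Rightarrow> 'q poly \<Rightarrow> nat \<Rightarrow>
   'q alg_closure \<Rightarrow> 'q alg_closure" where
  "frob_end \<phi> p r = (\<lambda>v. if v \<in> torsion \<phi> p then frob r v else 0)"

text \<open>\<open>\<kappa>[u]\<close> for an endomorphism \<open>u\<close> of \<open>M\<close>.\<close>

definition kappa_adjoin ::
  "('q::{field,finite} poly \<Rightarrow> 'q alg_closure poly) \<Rightarrow> 'q poly \<Rightarrow>
   ('q alg_closure \<Rightarrow> 'q alg_closure) \<Rightarrow> ('q alg_closure \<Rightarrow> 'q alg_closure) set" where
  "kappa_adjoin \<phi> p u =
     {(\<lambda>v. if v \<in> torsion \<phi> p then (\<Sum>i<N. kappa_act \<phi> (c i) ((u ^^ i) v)) else 0) | N c.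
        \<forall>i<N. c i \<in> kappa p}"

definition ring_S ::
  "('q::{field,finite} poly \<Rightarrow> 'q alg_closure poly) \<Rightarrow> 'q poly \<Rightarrow> nat \<Rightarrow>
   ('q alg_closure \<Rightarrow> 'q alg_closure) set" where
  "ring_S \<phi> p r = kappa_adjoin \<phi> p (frob_end \<phi> p r)"

definition ring_R0 ::
  "('q::{field,finite} poly \<Rightarrow> 'q alg_closure poly) \<Rightarrow> 'q poly \<Rightarrow> nat \<Rightarrow> nat \<Rightarrow>
   ('q alg_closure \<Rightarrow> 'q alg_closure) set" where
  "ring_R0 \<phi> p r m = kappa_adjoin \<phi> p (frob_end \<phi> p r ^^ m)"

definition ring_R ::
  "('q::{field,finite} poly \<Rightarrow> 'q alg_closure poly) \<Rightarrow> 'q poly \<Rightarrow> nat \<Rightarrow> nat \<Rightarrow>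
   ('q alg_closure \<Rightarrow> 'q alg_closure) set" where
  "ring_R \<phi> p r m = {f \<in> End_kappa \<phi> p. \<forall>g\<in>ring_R0 \<phi> p r m. f \<circ> g = g \<circ> f}"

definition Ann_R ::
  "('q::{field,finite} poly \<Rightarrow> 'q alg_closure poly) \<Rightarrow> 'q poly \<Rightarrow> nat \<Rightarrow> nat \<Rightarrow>
   'q alg_closure set \<Rightarrow> ('q alg_closure \<Rightarrow> 'q alg_closure) set" where
  "Ann_R \<phi> p r m W = {f \<in> ring_R \<phi> p r m. \<forall>w\<in>W. f w = 0}"

section \<open>Rank weight\<close>

definition scale_ac :: "'q::field \<Rightarrow> 'q alg_closure \<Rightarrow> 'q alg_closure" where
  "scale_ac c x = to_ac c * x"

definition scale_end ::
  "'q::field \<Rightarrow> ('q alg_closure \<Rightarrow> 'q alg_closure) \<Rightarrow> 'q alg_closure \<Rightarrow> 'q alg_closure" where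
  "scale_end c f = (\<lambda>v. to_ac c * f v)"

text \<open>These facts make \<open>module.span\<close>, \<open>module.dependent\<close> and \<open>vector_space.dim\<close> below meaningful.\<close>

lemma vector_space_scale_ac: "vector_space (scale_ac :: 'q::field \<Rightarrow> _)"
  by unfold_locales (simp_all add: scale_ac_def algebra_simps)

lemma vector_space_scale_end: "vector_space (scale_end :: 'q::field \<Rightarrow> _)"
  by unfold_locales (simp_all add: scale_end_def algebra_simps fun_eq_iff)

definition Fq_basis ::
  "('q::field alg_closure \<Rightarrow> 'q alg_closure) set \<Rightarrow> nat \<Rightarrow>
   (nat \<Rightarrow> 'q alg_closure \<Rightarrow> 'q alg_closure) \<Rightarrow> bool" where
  "Fq_basis V N s \<longleftrightarrow>
     inj_on s {1..N} \<and>
     \<not> module.dependent scale_end (s ` {1..N}) \<and>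
     module.span scale_end (s ` {1..N}) = V"

text \<open>The coefficients \<open>b\<^sub>j \<in> L = \<bbbF>\<^bsub>q^m\<^esub>\<close> in \<open>f = \<Sum>\<^sub>j b\<^sub>j s\<^sub>j\<close>; \<open>L\<close> acts by scalar multiplication.\<close>

definition rank_coeffs ::
  "nat \<Rightarrow> nat \<Rightarrow> (nat \<Rightarrow> 'q::{field,finite} alg_closure \<Rightarrow> 'q alg_closure) \<Rightarrow>
   ('q alg_closure \<Rightarrow> 'q alg_closure) \<Rightarrow> nat \<Rightarrow> 'q alg_closure" where
  "rank_coeffs m N s f =
     (THE b. b \<in> {1..N} \<rightarrow>\<^sub>E subfield_Fq m \<and> f = (\<lambda>v. \<Sum>j=1..N. b j * s j v))"

definition rank_wt ::
  "nat \<Rightarrow> nat \<Rightarrow> (nat \<Rightarrow> 'q::{field,finite} alg_closure \<Rightarrow> 'q alg_closure) \<Rightarrow>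
   ('q alg_closure \<Rightarrow> 'q alg_closure) \<Rightarrow> nat" where
  "rank_wt m N s f =
     vector_space.dim scale_ac (module.span scale_ac (rank_coeffs m N s f ` {1..N}))"

definition min_rank_dist ::
  "nat \<Rightarrow> nat \<Rightarrow> (nat \<Rightarrow> 'q::{field,finite} alg_closure \<Rightarrow> 'q alg_closure) \<Rightarrow>
   ('q alg_closure \<Rightarrow> 'q alg_closure) set \<Rightarrow> nat" where
  "min_rank_dist m N s C = Min (rank_wt m N s ` (C - {0}))"

section \<open>Rank-BCH codes\<close>

definition S_normal ::
  "('q::{field,finite} poly \<Rightarrow> 'q alg_closure poly) \<Rightarrow> 'q poly \<Rightarrow> nat \<Rightarrow> nat \<Rightarrow>
   'q alg_closure \<Rightarrow> bool" where
  "S_normal \<phi> p r n \<alpha> \<longleftrightarrow> \<alpha> \<in> torsion \<phi> p \<and>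
     (\<forall>v\<in>torsion \<phi> p. \<exists>!c. c \<in> {..<n} \<rightarrow>\<^sub>E kappa p \<and>
        v = (\<Sum>i<n. kappa_act \<phi> (c i) (frob (r * i) \<alpha>)))"

text \<open>\<open>W\<^sub>\<delta>\<close> for \<open>\<delta> \<ge> 1\<close>; the index range \<open>0 \<le> i \<le> \<delta> - 2\<close> is \<open>{..<\<delta> - 1}\<close>, empty for \<open>\<delta> = 1\<close>.\<close>

definition W_space ::
  "('q::{field,finite} poly \<Rightarrow> 'q alg_closure poly) \<Rightarrow> 'q poly \<Rightarrow> nat \<Rightarrow> nat \<Rightarrow>
   'q alg_closure \<Rightarrow> nat \<Rightarrow> 'q alg_closure set" where
  "W_space \<phi> p r m \<alpha> \<delta> =
     {(\<Sum>i<\<delta> - 1. \<rho> i (frob (r * i) \<alpha>)) | \<rho>. \<forall>i<\<delta> - 1. \<rho> i \<in> ring_R0 \<phi> p r m}"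

definition rank_BCH ::
  "('q::{field,finite} poly \<Rightarrow> 'q alg_closure poly) \<Rightarrow> 'q poly \<Rightarrow> nat \<Rightarrow> nat \<Rightarrow>
   'q alg_closure \<Rightarrow> nat \<Rightarrow> ('q alg_closure \<Rightarrow> 'q alg_closure) set" where
  "rank_BCH \<phi> p r m \<alpha> \<delta> = Ann_R \<phi> p r m (W_space \<phi> p r m \<alpha> \<delta>)"

end

theory Submission
  imports Defs
begin

text \<open>
  Write \<open>\<pi>\<close> for the Frobenius \<open>v \<mapsto> v\<^bsup>[r]\<^esup>\<close>, \<open>M\<close> for the torsion module, \<open>L = \<bbbF>\<^bsub>q^m\<^esub>\<close>, and \<open>N = nd\<close>, so that
  normality of \<open>\<alpha>\<close> gives \<open>|M| = q\<^sup>N\<close>. The code consists of the \<open>f \<in> R\<close> that vanish at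
  \<open>\<alpha>, \<pi>\<alpha>, \<dots>, \<pi>\<^bsup>\<delta>-2\<^esup>\<alpha>\<close> (\<open>rank_BCH_iff\<close>), and everything comes from one uniqueness statement and
  from counting.

  Uniqueness (\<open>combination_vanishing\<close>): let \<open>f = \<Sum> b\<^sub>j s\<^sub>j\<close> have coefficients \<open>b\<^sub>j \<in> L\<close> that span an
  \<open>\<bbbF>\<^sub>q\<close>-space of dimension \<open>w\<close>. If \<open>f\<close> vanishes at \<open>\<pi>\<^sup>i\<alpha>\<close> for all \<open>i < w\<close>, then every \<open>b\<^sub>j\<close> is \<open>0\<close>. To
  see this, write \<open>f = \<Sum> \<beta>\<^sub>k x\<^sub>k\<close> with a basis \<open>\<beta>\<^sub>1, \<dots>, \<beta>\<^sub>w\<close> of that space and \<open>x\<^sub>k \<in> S\<close>. Since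
  \<open>x\<^sub>k\<close> commutes with \<open>\<pi>\<close>, applying powers of \<open>\<pi>\<close> turns the \<open>w\<close> equations into a linear system for the
  elements \<open>\<pi>\<^bsup>w-1\<^esup>(x\<^sub>k\<alpha>)\<close> whose matrix is the Moore matrix \<open>(\<beta>\<^sub>k\<^bsup>[ri]\<^esup>)\<close>. As \<open>r\<close> is prime to \<open>m\<close>, the fixed
  field of \<open>\<pi>\<close> on \<open>L\<close> is \<open>\<bbbF>\<^sub>q\<close>, and the system has only the trivial solution
  (\<open>moore_system_trivial\<close>). So \<open>x\<^sub>k\<alpha> = 0\<close>, and \<open>x\<^sub>k = 0\<close> because evaluation at \<open>\<alpha>\<close> is injective on \<open>S\<close>.

  Counting: uniqueness makes \<open>L\<^sup>N \<rightarrow> R\<close>, \<open>b \<mapsto> \<Sum> b\<^sub>j s\<^sub>j\<close>, injective. The map \<open>R \<rightarrow> M\<^sup>m\<close>,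
  \<open>f \<mapsto> (f(\<pi>\<^sup>i\<alpha>))\<^bsub>i<m\<^esub>\<close>, is injective as well, because \<open>f\<close> commutes with \<open>\<kappa>\<close> and \<open>\<pi>\<^sup>m\<close> and the \<open>\<pi>\<^sup>i\<alpha>\<close>
  with \<open>i < n\<close> span \<open>M\<close> over \<open>\<kappa>\<close>. Since \<open>L\<^sup>N\<close> and \<open>M\<^sup>m\<close> both have \<open>q\<^bsup>mN\<^esup>\<close> elements, both maps are bijective
  (\<open>bij_betw_combination\<close>, \<open>bij_betw_basis_values\<close>). Thus the code corresponds to the tuples in
  \<open>M\<^sup>m\<close> whose first \<open>\<delta> - 1\<close> entries are \<open>0\<close>, which gives its dimension.

  Distance: by uniqueness a nonzero codeword cannot have weight at most \<open>\<delta> - 1\<close>. Conversely, let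
  \<open>V \<subseteq> L\<close> have dimension \<open>\<delta>\<close>. The \<open>q\<^bsup>\<delta>N\<^esup>\<close> families with values in \<open>V\<close> are mapped to \<open>M\<^bsup>\<delta>-1\<^esup>\<close>, which is
  smaller; the difference of two families with the same image gives a nonzero codeword with
  coefficients in \<open>V\<close>, hence of weight at most \<open>\<delta>\<close>.
\<close>

section \<open>The Frobenius map\<close>

lemma CARD_field_gt_1: "CARD('q::{field,finite}) > 1"
  using card_mono[of UNIV "{0, 1 :: 'q}"] by simp

lemma power_CARD_eq_self: "x ^ CARD('q) = x" for x :: "'q::{field,finite}"
proof (cases "x = 0")
  case False
  have "x * (\<Prod>y\<in>UNIV-{0}. x * y) = x * x ^ (CARD('q) - 1) * \<Prod>(UNIV-{0})"
    by (simp add: prod.distrib mult_ac)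
  also have "x * x ^ (CARD('q) - 1) = x ^ CARD('q)"
    by (simp flip: power_Suc)
  also have "(\<Prod>y\<in>UNIV-{0}. x * y) = (\<Prod>y\<in>UNIV-{0}. y)"
    by (rule prod.reindex_bij_witness[of _ "\<lambda>y. y / x" "\<lambda>y. x * y"]) (use False in auto)
  finally show ?thesis
    by simp
qed simp

lemma of_nat_CARD_eq_0: "of_nat CARD('q) = (0 :: 'q::{field,finite})"
proof -
  have "(\<Sum>x\<in>UNIV. x + 1 :: 'q) = (\<Sum>x\<in>UNIV. x)"
    by (rule sum.reindex_bij_witness[of _ "\<lambda>x. x - 1" "\<lambda>x. x + 1"]) auto
  then show ?thesis
    by (simp add: sum.distrib)
qed

lemma frob_to_ac [simp]: "frob i (to_ac c) = to_ac c"
  by (induction i) (simp_all add: frob_def power_mult power_CARD_eq_self flip: to_ac_power)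

lemma to_ac_power_CARD [simp]: "to_ac c ^ CARD('q) = to_ac c" for c :: "'q::{field,finite}"
  by (simp add: power_CARD_eq_self flip: to_ac_power)

text \<open>
  Both sides are monic of degree \<open>q\<close> in \<open>x\<close> and vanish on the \<open>q\<close> elements of \<open>\<bbbF>\<^sub>q\<close>. Additivity of the
  Frobenius follows from this factorization, because the product is invariant under
  translations of \<open>x\<close> by \<open>\<bbbF>\<^sub>q\<close>.
\<close>
lemma power_CARD_minus_self_eq_prod:
  "x ^ CARD('q) - x = (\<Prod>c\<in>UNIV. x - to_ac c)" for x :: "'q::{field,finite} alg_closure"
proof -
  let ?p = "monom 1 CARD('q) - [:0, 1:] :: 'q alg_closure poly"
  let ?g = "\<Prod>c\<in>UNIV. [:- to_ac c, 1:] :: 'q alg_closure poly"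
  have q: "CARD('q) > 1"
    by (rule CARD_field_gt_1)
  have dg: "degree ?g = CARD('q)"
    by (subst degree_prod_eq_sum_degree) auto
  have lg: "lead_coeff ?g = 1"
    by (subst lead_coeff_prod) auto
  have "?p = ?g"
  proof (rule poly_eqI_degree_lead_coeff)
    show "coeff ?p CARD('q) = coeff ?g CARD('q)"
      using q lg unfolding dg by (simp add: coeff_pCons split: nat.split)
    show "CARD('q) \<le> card (range (to_ac :: 'q \<Rightarrow> _))"
      by (simp add: card_image inj_to_ac)
    show "degree ?p \<le> CARD('q)"
      using q by (intro degree_diff_le) (auto simp: degree_monom_eq)
    show "degree ?g \<le> CARD('q)"
      by (simp add: dg)
    show "poly ?p z = poly ?g z" if "z \<in> range to_ac" for z
      using that by (auto simp: poly_monom poly_prod prod_zero_iff)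
  qed
  then have "poly ?p x = poly ?g x"
    by simp
  then show ?thesis
    by (simp add: poly_monom poly_prod)
qed

lemma power_CARD_add:
  "(x + y) ^ CARD('q) = x ^ CARD('q) + y ^ CARD('q)" for x y :: "'q::{field,finite} alg_closure"
proof -
  have q: "CARD('q) > 1"
    by (rule CARD_field_gt_1)
  have shift: "(to_ac c + y) ^ CARD('q) = to_ac c + y ^ CARD('q)" for c
  proof -
    have "(to_ac c + y) ^ CARD('q) - (to_ac c + y) = (\<Prod>e\<in>UNIV. to_ac c + y - to_ac e)"
      by (rule power_CARD_minus_self_eq_prod)
    also have "\<dots> = (\<Prod>e\<in>UNIV. y - to_ac e)"
      by (rule prod.reindex_bij_witness[of _ "\<lambda>e. e + c" "\<lambda>e. e - c"]) auto
    also have "\<dots> = y ^ CARD('q) - y"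
      by (rule power_CARD_minus_self_eq_prod[symmetric])
    finally show ?thesis
      by (simp add: algebra_simps)
  qed
  \<comment> \<open>As polynomials in \<open>x\<close>, both sides are monic of degree \<open>q\<close>, so agreement on \<open>\<bbbF>\<^sub>q\<close> is enough.\<close>
  let ?f = "[:y, 1:] ^ CARD('q)"
  let ?g = "monom 1 CARD('q) + [:y ^ CARD('q):]"
  have df: "degree ?f = CARD('q)"
    by (simp add: degree_power_eq)
  have "?f = ?g"
  proof (rule poly_eqI_degree_lead_coeff)
    have "lead_coeff ?f = 1"
      by (simp add: lead_coeff_power)
    then show "coeff ?f CARD('q) = coeff ?g CARD('q)"
      using q unfolding df by (simp add: coeff_pCons split: nat.split)
    show "CARD('q) \<le> card (range (to_ac :: 'q \<Rightarrow> _))"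
      by (simp add: card_image inj_to_ac)
    show "degree ?g \<le> CARD('q)"
      by (intro degree_add_le) (auto simp: degree_monom_eq)
    show "poly ?f z = poly ?g z" if "z \<in> range to_ac" for z
      using that shift by (auto simp: poly_monom add.commute)
  qed (simp add: df)
  then have "poly ?f x = poly ?g x"
    by simp
  then show ?thesis
    by (simp add: poly_monom add.commute)
qed

lemma frob_id [simp]: "frob 0 x = x"
  by (simp add: frob_def)

lemma frob_frob: "frob i (frob j x) = frob (i + j) x"
  by (simp add: frob_def power_add mult.commute flip: power_mult)

lemma frob_add: "frob i (x + y) = frob i x + frob i y"
  by (induction i) (simp_all add: frob_def power_mult power_CARD_add mult.commute[of "CARD('q)" for q])

lemma frob_mult: "frob i (x * y) = frob i x * frob i y"
  by (simp add: frob_def power_mult_distrib)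

lemma frob_divide: "frob i (x / y) = frob i x / frob i y"
  by (simp add: frob_def power_divide)

lemma frob_0 [simp]: "frob i 0 = 0"
  by (simp add: frob_def)

lemma frob_1_right [simp]: "frob i 1 = 1"
  by (simp add: frob_def)

lemma frob_eq_0_iff [simp]: "frob i x = 0 \<longleftrightarrow> x = 0"
  by (simp add: frob_def)

lemma frob_minus: "frob i (- x) = - frob i x"
  using frob_add[of i x "- x"] by (simp add: eq_neg_iff_add_eq_0 add.commute)

lemma frob_diff: "frob i (x - y) = frob i x - frob i y"
  using frob_add[of i x "- y"] by (simp add: frob_minus)

lemma frob_sum: "frob i (sum f A) = (\<Sum>a\<in>A. frob i (f a))"
  by (induction A rule: infinite_finite_induct) (simp_all add: frob_add)

lemma frob_mult_fixed: "frob i x = x \<Longrightarrow> frob (i * k) x = x"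
  by (induction k) (simp_all flip: frob_frob)

lemma subfield_Fq_mono: "a dvd b \<Longrightarrow> x \<in> subfield_Fq a \<Longrightarrow> x \<in> subfield_Fq b"
  by (auto simp: subfield_Fq_def frob_mult_fixed elim: dvdE)

lemma frob_gcd_fixed:
  assumes "frob a x = x" "frob b x = x"
  shows "frob (gcd a b) x = x"
proof (cases "a = 0")
  case False
  obtain k l where "a * k = b * l + gcd a b"
    using bezout_nat[OF False] by blast
  then have "frob (gcd a b) (frob (b * l) x) = frob (a * k) x"
    by (simp add: frob_frob add.commute)
  then show ?thesis
    using assms by (simp add: frob_mult_fixed)
qed (use assms in simp)

lemma fixed_by_frob_1: "frob 1 x = x \<Longrightarrow> x \<in> range to_ac"
  using power_CARD_minus_self_eq_prod[of x] by (auto simp: frob_def)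

text \<open>\<open>X\<^bsup>Q\<^esup> - X\<close> with \<open>Q = q\<^sup>m\<close> has derivative \<open>-1\<close>, so its \<open>Q\<close> roots are distinct.\<close>
lemma card_subfield_Fq:
  assumes "m \<ge> 1"
  shows "card (subfield_Fq m :: 'q::{field,finite} alg_closure set) = CARD('q) ^ m"
    and "finite (subfield_Fq m :: 'q alg_closure set)"
proof -
  have q: "CARD('q) > 1"
    by (rule CARD_field_gt_1)
  define Q where "Q = CARD('q) ^ m"
  have Q: "Q > 1"
    unfolding Q_def using q assms by (intro one_less_power) auto
  define P where "P = monom 1 Q - [:0, 1 :: 'q alg_closure:]"
  have "of_nat CARD('q) = (0 :: 'q alg_closure)"
    by (metis of_nat_CARD_eq_0 to_ac_0 to_ac_of_nat)
  then have "of_nat Q = (0 :: 'q alg_closure)"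
    using assms by (simp add: Q_def)
  then have pderiv_P: "pderiv P = - 1"
    by (simp add: P_def pderiv_diff pderiv_monom pderiv_pCons one_pCons)
  have coeff_P: "coeff P Q = 1"
    using Q by (simp add: P_def coeff_pCons split: nat.split)
  have deg_P: "degree P = Q"
  proof (rule antisym)
    show "degree P \<le> Q"
      unfolding P_def using Q by (intro degree_diff_le) (auto simp: degree_monom_eq)
    show "Q \<le> degree P"
      by (rule le_degree) (simp add: coeff_P)
  qed
  obtain A where A: "size A = degree P" "P = smult (lead_coeff P) (\<Prod>x\<in>#A. [:-x, 1:])"
    using alg_closed_imp_factorization[of P] coeff_P by force
  have "count A a \<le> 1" for a
  proof (rule ccontr)
    assume "\<not> count A a \<le> 1"
    then have "replicate_mset 2 a \<subseteq># A"
      by (simp flip: count_le_replicate_mset_subset_eq)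
    then obtain B where "A = replicate_mset 2 a + B"
      by (auto simp: subset_mset.le_iff_add)
    then have "(\<Prod>x\<in>#A. [:-x, 1:]) = [:-a, 1:] * ([:-a, 1:] * (\<Prod>x\<in>#B. [:-x, 1:]))"
      by (simp only: image_mset_union image_replicate_mset prod_mset.union prod_mset_replicate_mset
          power2_eq_square mult.assoc)
    then have "P = [:-a, 1:] * ([:-a, 1:] * (\<Prod>x\<in>#B. [:-x, 1:]))"
      using A(2) coeff_P deg_P by (metis smult_1_left)
    then have "poly (pderiv P) a = 0"
      by (simp add: pderiv_mult del: mult_pCons_left)
    then show False
      by (simp add: pderiv_P)
  qed
  then have A_mset: "A = mset_set (set_mset A)"
    by (intro multiset_eqI)
      (metis count_eq_zero_iff count_greater_eq_one_iff count_mset_set(1,3) finite_set_mset le_antisym)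
  have "x \<in> set_mset A \<longleftrightarrow> poly P x = 0" for x
    using coeff_P deg_P by (subst A(2)) (auto simp: poly_prod_mset prod_mset_zero_iff image_iff)
  then have "set_mset A = subfield_Fq m"
    by (auto simp: P_def poly_monom subfield_Fq_def frob_def Q_def)
  then show "card (subfield_Fq m :: 'q alg_closure set) = CARD('q) ^ m"
    and "finite (subfield_Fq m :: 'q alg_closure set)"
    using A(1) A_mset deg_P Q_def by (metis size_mset_set, metis finite_set_mset)
qed

lemma subfield_Fq_closed:
  "0 \<in> subfield_Fq m" "1 \<in> subfield_Fq m" "to_ac c \<in> subfield_Fq m"
  "x \<in> subfield_Fq m \<Longrightarrow> y \<in> subfield_Fq m \<Longrightarrow> x + y \<in> subfield_Fq m"
  "x \<in> subfield_Fq m \<Longrightarrow> y \<in> subfield_Fq m \<Longrightarrow> x - y \<in> subfield_Fq m"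
  "x \<in> subfield_Fq m \<Longrightarrow> y \<in> subfield_Fq m \<Longrightarrow> x * y \<in> subfield_Fq m"
  "x \<in> subfield_Fq m \<Longrightarrow> y \<in> subfield_Fq m \<Longrightarrow> x / y \<in> subfield_Fq m"
  by (auto simp: subfield_Fq_def frob_add frob_diff frob_mult frob_divide)

lemma subfield_Fq_frob: "x \<in> subfield_Fq m \<Longrightarrow> frob j x \<in> subfield_Fq m"
  by (metis (mono_tags) add.commute frob_frob mem_Collect_eq subfield_Fq_def)

lemma subfield_Fq_sum: "(\<And>a. a \<in> A \<Longrightarrow> f a \<in> subfield_Fq m) \<Longrightarrow> sum f A \<in> subfield_Fq m"
  by (induction A rule: infinite_finite_induct) (auto intro: subfield_Fq_closed)

section \<open>Finite vector spaces over a finite field\<close>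

interpretation ac: vector_space "scale_ac :: 'q::field \<Rightarrow> _"
  by (rule vector_space_scale_ac)

interpretation endo: vector_space "scale_end :: 'q::field \<Rightarrow> _"
  by (rule vector_space_scale_end)

lemma card_span_independent:
  fixes scale :: "'q::{field,finite} \<Rightarrow> 'b::ab_group_add \<Rightarrow> 'b"
  assumes "vector_space scale" "finite B" "\<not> module.dependent scale B"
  shows "card (module.span scale B) = CARD('q) ^ card B"
proof -
  interpret vector_space scale by fact
  have "bij_betw (\<lambda>u. \<Sum>v\<in>B. scale (u v) v) (B \<rightarrow>\<^sub>E UNIV) (span B)"
  proof (rule bij_betw_imageI)
    show "inj_on (\<lambda>u. \<Sum>v\<in>B. scale (u v) v) (B \<rightarrow>\<^sub>E UNIV)"
    proof (rule inj_onI)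
      fix u w assume uw: "u \<in> B \<rightarrow>\<^sub>E UNIV" "w \<in> B \<rightarrow>\<^sub>E UNIV"
        and eq: "(\<Sum>v\<in>B. scale (u v) v) = (\<Sum>v\<in>B. scale (w v) v)"
      then have "(\<Sum>v\<in>B. scale (u v - w v) v) = 0"
        by (simp add: scale_left_diff_distrib sum_subtractf)
      then have "u v - w v = 0" if "v \<in> B" for v
        using assms(2,3) that dependent_finite[of B] by metis
      then show "u = w"
        using uw by (intro PiE_ext[of u B _ w]) auto
    qed
    have "(\<Sum>v\<in>B. scale (u v) v) \<in> (\<lambda>u. \<Sum>v\<in>B. scale (u v) v) ` (B \<rightarrow>\<^sub>E UNIV)" for u
      by (rule image_eqI[of _ _ "restrict u B"]) (auto intro!: sum.cong)
    then show "(\<lambda>u. \<Sum>v\<in>B. scale (u v) v) ` (B \<rightarrow>\<^sub>E UNIV) = span B"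
      by (auto simp: span_finite[OF assms(2)])
  qed
  then show ?thesis
    by (simp add: card_PiE assms(2) flip: bij_betw_same_card)
qed

lemma card_eq_power_dim:
  fixes scale :: "'q::{field,finite} \<Rightarrow> 'b::ab_group_add \<Rightarrow> 'b"
  assumes "vector_space scale" "module.subspace scale V" "finite V"
  shows "card V = CARD('q) ^ vector_space.dim scale V"
proof -
  interpret vector_space scale by fact
  obtain B where B: "B \<subseteq> V" "independent B" "V \<subseteq> span B" "card B = dim V"
    using basis_exists by blast
  then have "span B = V"
    using assms(2) span_minimal by blast
  then show ?thesis
    using card_span_independent[OF assms(1), of B] B assms(3) finite_subset by metis
qed

lemma dim_eqI_card:
  fixes scale :: "'q::{field,finite} \<Rightarrow> 'b::ab_group_add \<Rightarrow> 'b"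
  assumes "vector_space scale" "module.subspace scale V" "finite V" "card V = CARD('q) ^ k"
  shows "vector_space.dim scale V = k"
  using card_eq_power_dim[OF assms(1-3)] assms(4) CARD_field_gt_1[where 'q='q]
  by (simp add: power_inject_exp)

lemma sum_apply: "sum f A v = (\<Sum>a\<in>A. f a v)" for f :: "'i \<Rightarrow> 'x \<Rightarrow> 'y::comm_monoid_add"
  by (induction A rule: infinite_finite_induct) simp_all

lemma independent_imp_coeff_0:
  assumes "finite B" "ac.independent B" "(\<Sum>b\<in>B. to_ac (c b) * b) = 0" "b \<in> B"
  shows "c b = 0"
  using assms ac.dependent_finite[of B] by (auto simp: scale_ac_def)

lemma subspace_subfield_Fq: "ac.subspace (subfield_Fq m :: 'q::{field,finite} alg_closure set)"
  by (rule ac.subspaceI) (auto simp: scale_ac_def intro: subfield_Fq_closed)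

section \<open>Moore systems\<close>

text \<open>
  Induction on the number of unknowns. After division by one \<open>\<beta>\<^sub>a\<close>, the column of \<open>a\<close> is constantly \<open>1\<close>,
  so subtracting consecutive equations removes it and leaves a Moore system for the elements
  \<open>\<gamma>\<^sub>k - \<gamma>\<^sub>k\<^bsup>[r]\<^esup>\<close> with \<open>\<gamma>\<^sub>k = \<beta>\<^sub>k / \<beta>\<^sub>a\<close>. These are again independent: on \<open>\<bbbF>\<^bsub>q^m\<^esub>\<close> with \<open>m\<close> prime to \<open>r\<close>,
  the kernel of \<open>g \<mapsto> g - g\<^bsup>[r]\<^esup>\<close> is \<open>\<bbbF>\<^sub>q\<close>, the span of \<open>\<gamma>\<^sub>a = 1\<close>.
\<close>
lemma moore_system_trivial:
  fixes \<beta> z :: "'i \<Rightarrow> 'q::{field,finite} alg_closure"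
  assumes "finite I" "coprime m r"
    and "\<And>k. k \<in> I \<Longrightarrow> \<beta> k \<in> subfield_Fq m"
    and "\<And>c k. (\<Sum>k\<in>I. to_ac (c k) * \<beta> k) = 0 \<Longrightarrow> k \<in> I \<Longrightarrow> c k = 0"
    and "\<And>i. i < card I \<Longrightarrow> (\<Sum>k\<in>I. frob (r * i) (\<beta> k) * z k) = 0"
    and "k \<in> I"
  shows "z k = 0"
  using assms(1,3-)
proof (induction I arbitrary: \<beta> k rule: finite_induct)
  case (insert a J)
  have \<beta>_nonzero: "\<beta> a \<noteq> 0"
  proof
    assume "\<beta> a = 0"
    then have "(\<Sum>k\<in>insert a J. to_ac (if k = a then 1 else 0) * \<beta> k) = 0"
      using insert.hyps by (intro sum.neutral) auto
    from insert.prems(2)[OF this, of a] show False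
      by simp
  qed
  define \<gamma> where "\<gamma> k = \<beta> k / \<beta> a" for k
  have \<gamma>: "\<gamma> k \<in> subfield_Fq m" if "k \<in> insert a J" for k
    unfolding \<gamma>_def using insert.prems(1) that by (intro subfield_Fq_closed) auto
  have \<gamma>_a: "\<gamma> a = 1"
    using \<beta>_nonzero by (simp add: \<gamma>_def)
  have \<gamma>_indep: "c k = 0" if "(\<Sum>k\<in>insert a J. to_ac (c k) * \<gamma> k) = 0" "k \<in> insert a J" for c k
  proof -
    have "(\<Sum>k\<in>insert a J. to_ac (c k) * \<beta> k) = \<beta> a * (\<Sum>k\<in>insert a J. to_ac (c k) * \<gamma> k)"
      using \<beta>_nonzero by (simp add: \<gamma>_def sum_distrib_left)
    then show ?thesis
      using insert.prems(2)[OF _ that(2)] that(1) by simp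
  qed
  have \<gamma>_system: "(\<Sum>k\<in>insert a J. frob (r * i) (\<gamma> k) * z k) = 0" if "i < Suc (card J)" for i
  proof -
    have "frob (r * i) (\<beta> a) * (\<Sum>k\<in>insert a J. frob (r * i) (\<gamma> k) * z k)
        = (\<Sum>k\<in>insert a J. frob (r * i) (\<beta> k) * z k)"
      using \<beta>_nonzero by (simp add: \<gamma>_def frob_divide sum_distrib_left del: sum.insert)
    also have "\<dots> = 0"
      using insert.prems(3)[of i] insert.hyps that by simp
    finally show ?thesis
      using \<beta>_nonzero by simp
  qed
  have J_zero: "z k = 0" if "k \<in> J" for k
  proof (rule insert.IH[OF _ _ _ that])
    fix k assume "k \<in> J"
    then show "\<gamma> k - frob r (\<gamma> k) \<in> subfield_Fq m"
      by (intro subfield_Fq_closed subfield_Fq_frob \<gamma>) auto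
  next
    fix c k assume 0: "(\<Sum>k\<in>J. to_ac (c k) * (\<gamma> k - frob r (\<gamma> k))) = 0" and k: "k \<in> J"
    define g where "g = (\<Sum>k\<in>J. to_ac (c k) * \<gamma> k)"
    have "frob r g = g"
      unfolding g_def frob_sum frob_mult frob_to_ac
      using 0 by (simp add: right_diff_distrib sum_subtractf)
    moreover have "g \<in> subfield_Fq m"
      unfolding g_def by (intro subfield_Fq_sum subfield_Fq_closed \<gamma>) auto
    ultimately have "frob 1 g = g"
      using frob_gcd_fixed[of m g r] \<open>coprime m r\<close> by (simp add: subfield_Fq_def)
    then obtain e where e: "g = to_ac e"
      using fixed_by_frob_1 by blast
    define c' where "c' = c(a := - e)"
    have "(\<Sum>k\<in>J. to_ac (c' k) * \<gamma> k) = g"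
      unfolding g_def using insert.hyps by (intro sum.cong) (auto simp: c'_def)
    then have "(\<Sum>k\<in>insert a J. to_ac (c' k) * \<gamma> k) = 0"
      using insert.hyps \<gamma>_a by (simp add: e c'_def)
    then have "c' k = 0"
      using \<gamma>_indep k by blast
    then show "c k = 0"
      using k insert.hyps by (auto simp: c'_def split: if_splits)
  next
    fix i assume i: "i < card J"
    have "(\<Sum>k\<in>insert a J. frob (r * i) (\<gamma> k) * z k) - (\<Sum>k\<in>insert a J. frob (r * Suc i) (\<gamma> k) * z k) = 0"
      using \<gamma>_system[of i] \<gamma>_system[of "Suc i"] i by simp
    then show "(\<Sum>k\<in>J. frob (r * i) (\<gamma> k - frob r (\<gamma> k)) * z k) = 0"
      using insert.hyps \<gamma>_a
      by (simp add: frob_diff frob_frob sum_subtractf left_diff_distrib add.commute)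
  qed
  moreover have "z a = 0"
    using \<gamma>_system[of 0] insert.hyps \<gamma>_a J_zero by simp
  ultimately show ?case
    using insert.prems(4) by blast
qed simp

section \<open>Twisted polynomials as operators\<close>

lemma tw_apply_eq_sum: "degree f \<le> N \<Longrightarrow> tw_apply f v = (\<Sum>i\<le>N. coeff f i * frob i v)"
  unfolding tw_apply_def by (intro sum.mono_neutral_left) (auto simp: coeff_eq_0)

lemma tw_apply_add_left: "tw_apply (f + g) v = tw_apply f v + tw_apply g v"
proof -
  let ?N = "max (degree f) (degree g)"
  have "degree (f + g) \<le> ?N"
    by (rule degree_add_le_max)
  then show ?thesis
    by (simp add: tw_apply_eq_sum[of _ ?N] sum.distrib algebra_simps)
qed

lemma tw_apply_0_left [simp]: "tw_apply 0 v = 0"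
  by (simp add: tw_apply_def)

lemma tw_apply_sum_left: "tw_apply (sum f A) v = (\<Sum>a\<in>A. tw_apply (f a) v)"
  by (induction A rule: infinite_finite_induct) (simp_all add: tw_apply_add_left)

lemma tw_apply_smult: "tw_apply (smult c f) v = c * tw_apply f v"
  by (simp add: tw_apply_eq_sum[of _ "degree f"] degree_smult_le sum_distrib_left mult.assoc)

lemma tw_apply_monom: "tw_apply (monom c i) v = c * frob i v"
proof -
  have "tw_apply (monom c i) v = (\<Sum>k\<le>i. coeff (monom c i) k * frob k v)"
    by (rule tw_apply_eq_sum) (rule degree_monom_le)
  also have "\<dots> = (\<Sum>k\<in>{i}. coeff (monom c i) k * frob k v)"
    by (rule sum.mono_neutral_right) auto
  finally show ?thesis
    by simp
qed

lemma tw_apply_const: "tw_apply [:c:] v = c * v"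
  using tw_apply_monom[of c 0 v] by (simp add: monom_0)

lemma tw_apply_add: "tw_apply f (v + w) = tw_apply f v + tw_apply f w"
  by (simp add: tw_apply_def frob_add sum.distrib algebra_simps)

lemma tw_apply_mult: "tw_apply (tw_mult f g) v = tw_apply f (tw_apply g v)"
  unfolding tw_mult_def
  by (simp add: tw_apply_sum_left tw_apply_monom)
    (simp add: tw_apply_def frob_sum frob_mult frob_frob sum_distrib_left mult.assoc)

lemma tw_apply_frob:
  assumes "\<And>i. coeff f i \<in> subfield_Fq r"
  shows "frob r (tw_apply f v) = tw_apply f (frob r v)"
  using assms
  by (simp add: tw_apply_def frob_sum frob_mult frob_frob subfield_Fq_def add.commute)

section \<open>The residue field\<close>

lemma card_degree_less:
  assumes "d \<ge> 1"
  shows "card {a :: 'q::{field,finite} poly. degree a < d} = CARD('q) ^ d"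
proof -
  let ?F = "\<lambda>a :: 'q poly. restrict (coeff a) {..<d}"
  let ?G = "\<lambda>c :: nat \<Rightarrow> 'q. \<Sum>i<d. monom (c i) i"
  have "bij_betw ?F {a. degree a < d} ({..<d} \<rightarrow>\<^sub>E UNIV)"
  proof (rule bij_betw_byWitness[where f' = ?G])
    show "\<forall>a\<in>{a. degree a < d}. ?G (?F a) = a"
      by (auto simp: poly_eq_iff coeff_sum coeff_eq_0)
    show "\<forall>c\<in>{..<d} \<rightarrow>\<^sub>E UNIV. ?F (?G c) = c"
      by (auto simp: fun_eq_iff coeff_sum PiE_def extensional_def restrict_def)
    show "?G ` ({..<d} \<rightarrow>\<^sub>E UNIV) \<subseteq> {a. degree a < d}"
    proof safe
      fix c :: "nat \<Rightarrow> 'q"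
      have "degree (\<Sum>i<d. monom (c i) i) \<le> d - 1"
        by (rule degree_sum_le) (auto intro: order_trans[OF degree_monom_le])
      then show "degree (\<Sum>i<d. monom (c i) i) < d"
        using assms by simp
    qed
  qed (simp add: image_subset_iff restrict_PiE_iff)
  from bij_betw_same_card[OF this] show ?thesis
    by (simp add: card_PiE)
qed

definition residue_class :: "'q::{field,finite} poly \<Rightarrow> 'q poly \<Rightarrow> 'q poly set" where
  "residue_class p a = {b. p dvd a - b}"

lemma kappa_eq_range: "kappa p = range (residue_class p)"
  by (auto simp: kappa_def quotient_def residue_class_def)

lemma residue_class_eq_iff: "residue_class p a = residue_class p b \<longleftrightarrow> p dvd a - b"
proof
  assume eq: "residue_class p a = residue_class p b"
  have "b \<in> residue_class p a"
    unfolding eq by (simp add: residue_class_def)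
  then show "p dvd a - b"
    by (simp add: residue_class_def)
next
  assume *: "p dvd a - b"
  have "p dvd a - c \<longleftrightarrow> p dvd b - c" for c
    using dvd_add_right_iff[OF *, of "b - c"] by simp
  then show "residue_class p a = residue_class p b"
    by (simp add: residue_class_def)
qed

lemma card_kappa:
  fixes p :: "'q::{field,finite} poly"
  assumes "degree p \<ge> 1"
  shows "card (kappa p) = CARD('q) ^ degree p"
proof -
  have "bij_betw (residue_class p) {a. degree a < degree p} (kappa p)"
  proof (rule bij_betw_imageI)
    show "inj_on (residue_class p) {a. degree a < degree p}"
    proof (rule inj_onI)
      fix a b :: "'q poly"
      assume "a \<in> {a. degree a < degree p}" "b \<in> {a. degree a < degree p}"
      then have "degree (a - b) < degree p"
        by (auto intro: degree_diff_less)
      moreover assume "residue_class p a = residue_class p b"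
      ultimately show "a = b"
        using dvd_imp_degree_le[of p "a - b"] by (fastforce simp: residue_class_eq_iff)
    qed
    have "residue_class p a \<in> residue_class p ` {a. degree a < degree p}" for a
    proof (rule image_eqI)
      show "residue_class p a = residue_class p (a mod p)"
        by (simp add: residue_class_eq_iff minus_mod_eq_mult_div)
      show "a mod p \<in> {a. degree a < degree p}"
        using assms degree_mod_less[of p a] by (cases "p = 0") auto
    qed
    then show "residue_class p ` {a. degree a < degree p} = kappa p"
      by (auto simp: kappa_eq_range)
  qed
  from bij_betw_same_card[OF this] show ?thesis
    by (simp add: card_degree_less[OF assms])
qed

section \<open>The torsion module of the Drinfeld module\<close>

text \<open>
  Normality of \<open>\<alpha>\<close> carries the structure of the torsion module \<open>M\<close>: it gives \<open>|M| = |\<kappa>|\<^sup>n\<close> and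
  \<open>M = S\<alpha>\<close>. The shape of \<open>\<phi>\<^sub>T\<close> makes the action of \<open>A\<close> commute with scalars from \<open>\<bbbF>\<^bsub>q^n\<^esub>\<close>.
\<close>
locale normal_torsion =
  fixes \<phi> :: "'q::{field,finite} poly \<Rightarrow> 'q alg_closure poly"
    and p :: "'q poly" and t \<alpha> :: "'q alg_closure" and r n m :: nat
  assumes hom: "tw_algebra_hom r \<phi>"
    and \<phi>_T: "\<phi> [:0, 1:] = [:t:] + monom 1 n"
    and degree_p: "degree p \<ge> 1"
    and n_pos: "n \<ge> 1"
    and coprime_n_r: "coprime n r"
    and m_dvd_n: "m dvd n"
    and normal: "S_normal \<phi> p r n \<alpha>"
begin

abbreviation M where "M \<equiv> torsion \<phi> p"
abbreviation L :: "'q alg_closure set" where "L \<equiv> subfield_Fq m"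
abbreviation N where "N \<equiv> n * degree p"

definition act :: "'q poly \<Rightarrow> 'q alg_closure \<Rightarrow> 'q alg_closure" where
  "act a v = tw_apply (\<phi> a) v"

lemma m_pos: "m \<ge> 1"
  using m_dvd_n n_pos by (cases m) auto

lemma coprime_m_r: "coprime m r"
  using coprime_n_r m_dvd_n coprime_divisors[of m n r r] by simp

lemma act_add_left: "act (a + b) v = act a v + act b v"
  using hom by (simp add: act_def tw_algebra_hom_def tw_apply_add_left)

lemma act_0_left [simp]: "act 0 v = 0"
  using act_add_left[of 0 0 v] by (metis add_0 add_cancel_right_right)

lemma act_mult: "act (a * b) v = act a (act b v)"
  using hom by (simp add: act_def tw_algebra_hom_def tw_apply_mult)

lemma act_commute: "act a (act b v) = act b (act a v)"
  by (simp add: mult.commute flip: act_mult)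

lemma act_smult: "act (smult c a) v = to_ac c * act a v"
  using hom by (simp add: act_def tw_algebra_hom_def tw_apply_smult)

lemma act_1 [simp]: "act 1 v = v"
  using hom tw_apply_const[of 1 v] by (simp add: act_def tw_algebra_hom_def one_pCons)

lemma act_const: "act [:c:] v = to_ac c * v"
  using act_smult[of c 1 v] by simp

lemma act_add: "act a (v + w) = act a v + act a w"
  by (simp add: act_def tw_apply_add)

lemma act_0 [simp]: "act a 0 = 0"
  using act_add[of a 0 0] by (metis add_0 add_cancel_right_right)

lemma act_sum: "act a (sum f A) = (\<Sum>i\<in>A. act a (f i))"
  by (induction A rule: infinite_finite_induct) (simp_all add: act_add)

lemma act_frob: "frob (r * i) (act a v) = act a (frob (r * i) v)"
proof (induction i)
  case (Suc i)
  have "frob (r * Suc i) (act a v) = frob r (act a (frob (r * i) v))"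
    by (simp add: Suc flip: frob_frob)
  also have "\<dots> = act a (frob (r * Suc i) v)"
    using hom by (simp add: act_def tw_algebra_hom_def tw_apply_frob flip: frob_frob)
  finally show ?case .
qed simp

text \<open>
  It suffices to treat \<open>\<phi>\<^sub>T = t + \<tau>\<^sup>n\<close>, and \<open>\<tau>\<^sup>n\<close> commutes with multiplication by \<open>l\<close> because
  \<open>l\<^bsup>[n]\<^esup> = l\<close> for \<open>m dvd n\<close>.
\<close>
lemma act_L:
  assumes "l \<in> L"
  shows "act a (l * v) = l * act a v"
proof (induction a arbitrary: v)
  case (pCons c a)
  have l: "frob n l = l"
    using subfield_Fq_mono[OF m_dvd_n assms] by (simp add: subfield_Fq_def)
  have T: "act [:0, 1:] (l * v) = l * act [:0, 1:] v" for v
    by (simp add: act_def \<phi>_T tw_apply_add_left tw_apply_const tw_apply_monom frob_mult l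
        algebra_simps)
  have "pCons c a = [:c:] + [:0, 1:] * a"
    by simp
  then have "act (pCons c a) v = to_ac c * v + act [:0, 1:] (act a v)" for v
    by (simp only: act_add_left act_mult act_const)
  then show ?case
    by (simp add: pCons T algebra_simps)
qed simp

lemma M_iff: "v \<in> M \<longleftrightarrow> act p v = 0"
  by (simp add: torsion_def act_def)

lemma M_0 [simp]: "0 \<in> M"
  and M_add: "v \<in> M \<Longrightarrow> w \<in> M \<Longrightarrow> v + w \<in> M"
  and M_act: "v \<in> M \<Longrightarrow> act a v \<in> M"
  and M_frob: "v \<in> M \<Longrightarrow> frob (r * i) v \<in> M"
  and M_L: "l \<in> L \<Longrightarrow> v \<in> M \<Longrightarrow> l * v \<in> M"
  by (auto simp: M_iff act_add act_L mult.commute[of p] simp flip: act_mult act_frob)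
    (simp add: act_mult)

lemma M_sum: "(\<And>i. i \<in> A \<Longrightarrow> f i \<in> M) \<Longrightarrow> sum f A \<in> M"
  by (induction A rule: infinite_finite_induct) (auto intro: M_add)

lemma \<alpha>_in_M: "\<alpha> \<in> M"
  using normal by (simp add: S_normal_def)

lemma kappa_act_residue_class:
  assumes "v \<in> M"
  shows "kappa_act \<phi> (residue_class p a) v = act a v"
proof -
  define b where "b = (SOME b. b \<in> residue_class p a)"
  have "b \<in> residue_class p a"
    unfolding b_def by (rule someI[of _ a]) (simp add: residue_class_def)
  then obtain k where "a = b + k * p"
    by (auto simp: residue_class_def dvd_def algebra_simps)
  then have "act a v = act b v"
    using assms by (simp add: act_add_left act_mult M_iff)
  then show ?thesis
    by (simp add: kappa_act_def act_def b_def)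
qed

text \<open>Lets all further arguments work with polynomials instead of residue classes.\<close>
lemma kappa_representatives:
  assumes "\<And>i. i \<in> A \<Longrightarrow> c i \<in> kappa p"
  obtains a where "\<And>i v. i \<in> A \<Longrightarrow> v \<in> M \<Longrightarrow> kappa_act \<phi> (c i) v = act (a i) v"
proof -
  have "\<forall>i\<in>A. \<exists>a. c i = residue_class p a"
    using assms by (auto simp: kappa_eq_range)
  then obtain a where "\<forall>i\<in>A. c i = residue_class p (a i)"
    by metis
  then show thesis
    by (intro that[of a]) (simp add: kappa_act_residue_class)
qed

lemma normal_expansion:
  assumes "v \<in> M"
  obtains a where "v = (\<Sum>i<n. act (a i) (frob (r * i) \<alpha>))"
proof -
  obtain c where c: "c \<in> {..<n} \<rightarrow>\<^sub>E kappa p"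
    and v: "v = (\<Sum>i<n. kappa_act \<phi> (c i) (frob (r * i) \<alpha>))"
    using normal assms by (auto simp: S_normal_def)
  obtain a where "\<And>i v. i \<in> {..<n} \<Longrightarrow> v \<in> M \<Longrightarrow> kappa_act \<phi> (c i) v = act (a i) v"
    using kappa_representatives[of "{..<n}" c] c by blast
  then show thesis
    using v M_frob[OF \<alpha>_in_M] by (intro that[of a]) simp
qed

lemma card_M: "card M = CARD('q) ^ N" and finite_M: "finite M"
proof -
  let ?f = "\<lambda>c. \<Sum>i<n. kappa_act \<phi> (c i) (frob (r * i) \<alpha>)"
  have ex1: "\<exists>!c. c \<in> {..<n} \<rightarrow>\<^sub>E kappa p \<and> v = ?f c" if "v \<in> M" for v
    using normal that by (auto simp: S_normal_def)
  have in_M: "?f c \<in> M" if "c \<in> {..<n} \<rightarrow>\<^sub>E kappa p" for c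
  proof (rule M_sum)
    fix i assume "i \<in> {..<n}"
    then have "c i \<in> kappa p"
      using that by blast
    then obtain a where "c i = residue_class p a"
      by (auto simp: kappa_eq_range)
    then show "kappa_act \<phi> (c i) (frob (r * i) \<alpha>) \<in> M"
      by (simp add: kappa_act_residue_class M_frob M_act \<alpha>_in_M)
  qed
  have inj: "inj_on ?f ({..<n} \<rightarrow>\<^sub>E kappa p)"
  proof (rule inj_onI)
    fix c e
    assume c: "c \<in> {..<n} \<rightarrow>\<^sub>E kappa p" and "e \<in> {..<n} \<rightarrow>\<^sub>E kappa p" "?f c = ?f e"
    then show "c = e"
      using ex1[OF in_M[OF c]] by blast
  qed
  have image: "?f ` ({..<n} \<rightarrow>\<^sub>E kappa p) = M"
  proof (intro equalityI subsetI)
    fix v assume "v \<in> M"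
    from ex1[OF this] show "v \<in> ?f ` ({..<n} \<rightarrow>\<^sub>E kappa p)"
      by (elim ex1E conjE) (rule image_eqI)
  qed (use in_M in \<open>elim imageE, simp only:\<close>)
  have "card M = card ({..<n} \<rightarrow>\<^sub>E kappa p)"
    by (subst image[symmetric]) (rule card_image[OF inj])
  then show "card M = CARD('q) ^ N"
    by (simp add: card_PiE card_kappa[OF degree_p] mult.commute[of n] power_mult)
  then show "finite M"
    using card_ge_0_finite[of M] by simp
qed

section \<open>Endomorphisms\<close>

lemma End_kappa_iff:
  "f \<in> End_kappa \<phi> p \<longleftrightarrow>
     (\<forall>v. v \<notin> M \<longrightarrow> f v = 0) \<and> (\<forall>v\<in>M. f v \<in> M) \<and>
     (\<forall>v\<in>M. \<forall>w\<in>M. f (v + w) = f v + f w) \<and> (\<forall>a. \<forall>v\<in>M. f (act a v) = act a (f v))"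
  unfolding End_kappa_def by (auto simp: kappa_eq_range kappa_act_residue_class)

lemma End_kappa_sum:
  assumes "f \<in> End_kappa \<phi> p" "\<And>i. i \<in> A \<Longrightarrow> g i \<in> M"
  shows "f (sum g A) = (\<Sum>i\<in>A. f (g i))"
proof -
  have f0: "f 0 = 0"
    using assms(1) by (metis End_kappa_iff M_0 add_cancel_right_left)
  show ?thesis
    using assms(2)
  proof (induction A rule: infinite_finite_induct)
    case (insert a A)
    then have "f (g a + sum g A) = f (g a) + f (sum g A)"
      using assms(1) M_sum[of A g] by (simp add: End_kappa_iff)
    then show ?case
      using insert by simp
  qed (simp_all add: f0)
qed

lemma kappa_adjoin_eq:
  assumes "\<And>v. v \<in> M \<Longrightarrow> u v \<in> M"
  shows "kappa_adjoin \<phi> p u =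
    {(\<lambda>v. if v \<in> M then (\<Sum>i<k. act (a i) ((u ^^ i) v)) else 0) | k a. True}"
proof -
  have u_M: "(u ^^ i) v \<in> M" if "v \<in> M" for i v
    using that by (induction i) (auto intro: assms)
  show ?thesis
  proof (intro equalityI subsetI)
    fix x assume "x \<in> kappa_adjoin \<phi> p u"
    then obtain k c where x: "x = (\<lambda>v. if v \<in> M then (\<Sum>i<k. kappa_act \<phi> (c i) ((u ^^ i) v)) else 0)"
      and c: "\<forall>i<k. c i \<in> kappa p"
      by (auto simp: kappa_adjoin_def)
    obtain a where "\<And>i v. i \<in> {..<k} \<Longrightarrow> v \<in> M \<Longrightarrow> kappa_act \<phi> (c i) v = act (a i) v"
      using kappa_representatives[of "{..<k}" c] c by blast
    then have "x = (\<lambda>v. if v \<in> M then (\<Sum>i<k. act (a i) ((u ^^ i) v)) else 0)"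
      by (auto simp: x u_M fun_eq_iff)
    then show "x \<in> {(\<lambda>v. if v \<in> M then (\<Sum>i<k. act (a i) ((u ^^ i) v)) else 0) | k a. True}"
      by blast
  next
    fix x assume "x \<in> {(\<lambda>v. if v \<in> M then (\<Sum>i<k. act (a i) ((u ^^ i) v)) else 0) | k a. True}"
    then obtain k a where "x = (\<lambda>v. if v \<in> M then (\<Sum>i<k. act (a i) ((u ^^ i) v)) else 0)"
      by blast
    then have "x = (\<lambda>v. if v \<in> M then
        (\<Sum>i<k. kappa_act \<phi> (residue_class p (a i)) ((u ^^ i) v)) else 0)"
      by (auto simp: fun_eq_iff kappa_act_residue_class u_M)
    moreover have "\<forall>i<k. residue_class p (a i) \<in> kappa p"
      by (simp add: kappa_eq_range)
    ultimately show "x \<in> kappa_adjoin \<phi> p u"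
      unfolding kappa_adjoin_def
      by (intro CollectI exI[of _ k] exI[of _ "\<lambda>i. residue_class p (a i)"]) simp
  qed
qed

lemma frob_end_power: "v \<in> M \<Longrightarrow> (frob_end \<phi> p r ^^ i) v = frob (r * i) v"
  by (induction i) (auto simp: frob_end_def frob_frob M_frob)

text \<open>The element \<open>\<Sum>\<^bsub>i<k\<^esub> a\<^sub>i \<pi>\<^bsup>hi\<^esup>\<close> of \<open>\<kappa>[\<pi>\<^sup>h]\<close>; \<open>S\<close> is the case \<open>h = 1\<close> and \<open>R\<^sub>0\<close> the case \<open>h = m\<close>.\<close>
definition skew_sum :: "nat \<Rightarrow> nat \<Rightarrow> (nat \<Rightarrow> 'q poly) \<Rightarrow> 'q alg_closure \<Rightarrow> 'q alg_closure" where
  "skew_sum h k a = (\<lambda>v. if v \<in> M then (\<Sum>i<k. act (a i) (frob (r * (h * i)) v)) else 0)"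

lemma kappa_adjoin_frob: "kappa_adjoin \<phi> p (frob_end \<phi> p r ^^ h) = {skew_sum h k a | k a. True}"
proof -
  have "((frob_end \<phi> p r ^^ h) ^^ i) v = frob (r * (h * i)) v" if "v \<in> M" for v i
    using that by (simp add: frob_end_power funpow_mult)
  then have "skew_sum h k a =
      (\<lambda>v. if v \<in> M then (\<Sum>i<k. act (a i) (((frob_end \<phi> p r ^^ h) ^^ i) v)) else 0)" for k a
    by (auto simp: skew_sum_def fun_eq_iff)
  then show ?thesis
    by (subst kappa_adjoin_eq) (auto simp: frob_end_power M_frob)
qed

lemma ring_S_eq: "ring_S \<phi> p r = {skew_sum 1 k a | k a. True}"
  using kappa_adjoin_frob[of 1] by (simp add: ring_S_def)

lemma ring_R0_eq: "ring_R0 \<phi> p r m = {skew_sum m k a | k a. True}"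
  using kappa_adjoin_frob[of m] by (simp add: ring_R0_def)

lemma skew_sum_End: "skew_sum h k a \<in> End_kappa \<phi> p"
  unfolding End_kappa_iff skew_sum_def
  by (auto simp: M_add M_act M_frob frob_add act_add sum.distrib act_sum act_frob
      act_commute intro!: M_sum)

lemma skew_sum_frob: "v \<in> M \<Longrightarrow> skew_sum h k a (frob (r * i) v) = frob (r * i) (skew_sum h k a v)"
  by (simp add: skew_sum_def M_frob frob_sum act_frob frob_frob add.commute)

lemma skew_sum_extend:
  assumes "k \<le> K"
  shows "skew_sum h k a = skew_sum h K (\<lambda>i. if i < k then a i else 0)"
proof -
  have "(\<Sum>i<k. act (a i) (frob (r * (h * i)) v))
      = (\<Sum>i<K. act (if i < k then a i else 0) (frob (r * (h * i)) v))" for v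
    using assms by (intro sum.mono_neutral_cong_left) auto
  then show ?thesis
    by (simp add: skew_sum_def fun_eq_iff)
qed

lemma skew_sum_add:
  "\<exists>K c. skew_sum h k a + skew_sum h k' a' = skew_sum h K c"
proof -
  let ?K = "max k k'"
  define b where "b = (\<lambda>i. if i < k then a i else 0)"
  define b' where "b' = (\<lambda>i. if i < k' then a' i else 0)"
  have "skew_sum h k a = skew_sum h ?K b" "skew_sum h k' a' = skew_sum h ?K b'"
    using skew_sum_extend[of k ?K] skew_sum_extend[of k' ?K] by (simp_all add: b_def b'_def)
  then have "skew_sum h k a + skew_sum h k' a' = skew_sum h ?K (\<lambda>i. b i + b' i)"
    by (simp add: skew_sum_def fun_eq_iff act_add_left sum.distrib)
  then show ?thesis
    by blast
qed

lemma skew_sum_0: "skew_sum h 0 a = 0"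
  by (auto simp: skew_sum_def fun_eq_iff)

lemma scale_skew_sum: "scale_end c (skew_sum h k a) = skew_sum h k (\<lambda>i. smult c (a i))"
  by (simp add: skew_sum_def scale_end_def fun_eq_iff act_smult sum_distrib_left)

lemma subspace_S: "endo.subspace (ring_S \<phi> p r)"
proof (rule endo.subspaceI)
  show "0 \<in> ring_S \<phi> p r"
    unfolding ring_S_eq using skew_sum_0[of 1] by (metis (mono_tags, lifting) mem_Collect_eq)
next
  fix x y assume "x \<in> ring_S \<phi> p r" "y \<in> ring_S \<phi> p r"
  then show "x + y \<in> ring_S \<phi> p r"
    unfolding ring_S_eq using skew_sum_add by fastforce
next
  fix c x assume "x \<in> ring_S \<phi> p r"
  then show "scale_end c x \<in> ring_S \<phi> p r"
    unfolding ring_S_eq using scale_skew_sum by fastforce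
qed

lemma S_subset_End: "x \<in> ring_S \<phi> p r \<Longrightarrow> x \<in> End_kappa \<phi> p"
  by (auto simp: ring_S_eq skew_sum_End)

lemma S_frob: "x \<in> ring_S \<phi> p r \<Longrightarrow> v \<in> M \<Longrightarrow> x (frob (r * i) v) = frob (r * i) (x v)"
  by (auto simp: ring_S_eq skew_sum_frob)

lemma End_kappa_eqI:
  assumes "f \<in> End_kappa \<phi> p" "g \<in> End_kappa \<phi> p"
    and "\<And>i. i < n \<Longrightarrow> f (frob (r * i) \<alpha>) = g (frob (r * i) \<alpha>)"
  shows "f = g"
proof
  fix v
  show "f v = g v"
  proof (cases "v \<in> M")
    case True
    then obtain a where v: "v = (\<Sum>i<n. act (a i) (frob (r * i) \<alpha>))"
      by (rule normal_expansion)
    have "f v = (\<Sum>i<n. f (act (a i) (frob (r * i) \<alpha>)))"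
      unfolding v by (intro End_kappa_sum assms M_act M_frob \<alpha>_in_M)
    also have "\<dots> = (\<Sum>i<n. g (act (a i) (frob (r * i) \<alpha>)))"
      using assms M_frob[OF \<alpha>_in_M] by (intro sum.cong) (auto simp: End_kappa_iff)
    also have "\<dots> = g v"
      unfolding v by (intro End_kappa_sum[symmetric] assms M_act M_frob \<alpha>_in_M)
    finally show ?thesis .
  next
    case False
    then show ?thesis
      using assms by (simp add: End_kappa_iff)
  qed
qed

text \<open>\<open>S\<close> is commutative and \<open>M = S\<alpha>\<close>, so an element of \<open>S\<close> that kills \<open>\<alpha>\<close> kills all of \<open>M\<close>.\<close>
lemma bij_betw_S_M: "bij_betw (\<lambda>x. x \<alpha>) (ring_S \<phi> p r) M"
proof (rule bij_betw_imageI)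
  show "inj_on (\<lambda>x. x \<alpha>) (ring_S \<phi> p r)"
    using \<alpha>_in_M by (intro inj_onI End_kappa_eqI) (auto simp: S_frob S_subset_End)
  show "(\<lambda>x. x \<alpha>) ` ring_S \<phi> p r = M"
  proof (intro equalityI subsetI)
    fix v assume "v \<in> M"
    then obtain a where "v = (\<Sum>i<n. act (a i) (frob (r * i) \<alpha>))"
      by (rule normal_expansion)
    then have "v = skew_sum 1 n a \<alpha>"
      by (simp add: skew_sum_def \<alpha>_in_M)
    then show "v \<in> (\<lambda>x. x \<alpha>) ` ring_S \<phi> p r"
      by (auto simp: ring_S_eq)
  next
    fix v assume "v \<in> (\<lambda>x. x \<alpha>) ` ring_S \<phi> p r"
    then show "v \<in> M"
      using S_subset_End \<alpha>_in_M by (auto simp: End_kappa_iff)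
  qed
qed

lemma finite_S: "finite (ring_S \<phi> p r)" and card_S: "card (ring_S \<phi> p r) = CARD('q) ^ N"
  using bij_betw_finite[OF bij_betw_S_M] bij_betw_same_card[OF bij_betw_S_M]
  by (simp_all add: finite_M card_M)

lemma ex_basis_S: "\<exists>s. Fq_basis (ring_S \<phi> p r) N s"
proof -
  obtain B where B: "B \<subseteq> ring_S \<phi> p r" "endo.independent B" "ring_S \<phi> p r \<subseteq> endo.span B"
    "card B = endo.dim (ring_S \<phi> p r)"
    using endo.basis_exists by blast
  have "endo.dim (ring_S \<phi> p r) = N"
    by (intro dim_eqI_card vector_space_scale_end subspace_S finite_S card_S)
  moreover have "finite B"
    using B(1) finite_S finite_subset by blast
  ultimately obtain s where s: "bij_betw s {1..N} B"
    using ex_bij_betw_nat_finite_1[of B] B(4) by auto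
  have "endo.span B = ring_S \<phi> p r"
    using B subspace_S endo.span_minimal by blast
  then show ?thesis
    using s B(2) by (auto simp: Fq_basis_def bij_betw_def)
qed

section \<open>The centralizer\<close>

lemma commute_frob_power:
  assumes "\<And>v. v \<in> M \<Longrightarrow> f (frob (r * m) v) = frob (r * m) (f v)" "v \<in> M"
  shows "f (frob (r * (m * i)) v) = frob (r * (m * i)) (f v)"
proof (induction i)
  case (Suc i)
  have "f (frob (r * m) (frob (r * (m * i)) v)) = frob (r * m) (f (frob (r * (m * i)) v))"
    using assms M_frob by blast
  then show ?case
    by (simp add: Suc frob_frob distrib_left)
qed simp

lemma ring_R_iff:
  "f \<in> ring_R \<phi> p r m \<longleftrightarrow>
    f \<in> End_kappa \<phi> p \<and> (\<forall>v\<in>M. f (frob (r * m) v) = frob (r * m) (f v))"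
proof
  assume f: "f \<in> ring_R \<phi> p r m"
  have "f (frob (r * m) v) = frob (r * m) (f v)" if "v \<in> M" for v
  proof -
    \<comment> \<open>\<open>?g\<close> is \<open>\<pi>\<^sup>m\<close>, written as \<open>0 \<cdot> 1 + 1 \<cdot> \<pi>\<^sup>m\<close>.\<close>
    let ?g = "skew_sum m 2 (\<lambda>i. if i = 1 then 1 else 0)"
    have g: "?g w = frob (r * m) w" if "w \<in> M" for w
      using that by (simp add: skew_sum_def numeral_2_eq_2)
    have "?g \<in> ring_R0 \<phi> p r m"
      unfolding ring_R0_eq by blast
    then have "f \<circ> ?g = ?g \<circ> f"
      using f by (simp add: ring_R_def)
    moreover have "f v \<in> M"
      using f that by (simp add: ring_R_def End_kappa_iff)
    ultimately show ?thesis
      using that g by (metis comp_apply)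
  qed
  then show "f \<in> End_kappa \<phi> p \<and> (\<forall>v\<in>M. f (frob (r * m) v) = frob (r * m) (f v))"
    using f by (simp add: ring_R_def)
next
  assume f: "f \<in> End_kappa \<phi> p \<and> (\<forall>v\<in>M. f (frob (r * m) v) = frob (r * m) (f v))"
  then have f_frob: "f (frob (r * (m * i)) v) = frob (r * (m * i)) (f v)" if "v \<in> M" for i v
    using that by (intro commute_frob_power) auto
  have "f \<circ> skew_sum m k a = skew_sum m k a \<circ> f" for k a
  proof
    fix v
    show "(f \<circ> skew_sum m k a) v = (skew_sum m k a \<circ> f) v"
    proof (cases "v \<in> M")
      case True
      have "f (\<Sum>i<k. act (a i) (frob (r * (m * i)) v))
          = (\<Sum>i<k. f (act (a i) (frob (r * (m * i)) v)))"
        using f True by (intro End_kappa_sum M_act M_frob) auto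
      also have "\<dots> = (\<Sum>i<k. act (a i) (frob (r * (m * i)) (f v)))"
        using f M_frob[OF True] f_frob[OF True] by (intro sum.cong) (auto simp: End_kappa_iff)
      finally show ?thesis
        using f True by (simp add: skew_sum_def End_kappa_iff)
    next
      case False
      have "f 0 = 0"
        using End_kappa_sum[of f "{}"] f by simp
      then show ?thesis
        using f False by (simp add: skew_sum_def End_kappa_iff)
    qed
  qed
  then show "f \<in> ring_R \<phi> p r m"
    using f by (auto simp: ring_R_def ring_R0_eq)
qed

lemma R_frob:
  assumes "f \<in> ring_R \<phi> p r m" "v \<in> M"
  shows "f (frob (r * (m * i)) v) = frob (r * (m * i)) (f v)"
  using assms by (intro commute_frob_power) (auto simp: ring_R_iff)

lemma subspace_R: "endo.subspace (ring_R \<phi> p r m)"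
  by (rule endo.subspaceI)
    (auto simp: ring_R_iff End_kappa_iff scale_end_def frob_add frob_mult act_add M_add M_L act_L
      subfield_Fq_closed(3) distrib_left)

text \<open>
  With \<open>i = m \<cdot> (i div m) + i mod m\<close>, each \<open>\<pi>\<^sup>i\<alpha>\<close> is an image of one of the first \<open>m\<close> of them under a
  power of \<open>\<pi>\<^sup>m\<close>, and elements of \<open>R\<close> commute with those.
\<close>
lemma R_eqI:
  assumes "f \<in> ring_R \<phi> p r m" "g \<in> ring_R \<phi> p r m"
    and "\<And>i. i < m \<Longrightarrow> f (frob (r * i) \<alpha>) = g (frob (r * i) \<alpha>)"
  shows "f = g"
proof (rule End_kappa_eqI)
  fix i
  have "frob (r * i) \<alpha> = frob (r * (m * (i div m))) (frob (r * (i mod m)) \<alpha>)"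
    by (simp add: frob_frob flip: distrib_left)
  then show "f (frob (r * i) \<alpha>) = g (frob (r * i) \<alpha>)"
    using assms m_pos by (simp add: R_frob M_frob \<alpha>_in_M)
qed (use assms in \<open>simp_all add: ring_R_iff\<close>)

definition basis_values :: "('q alg_closure \<Rightarrow> 'q alg_closure) \<Rightarrow> nat \<Rightarrow> 'q alg_closure" where
  "basis_values f = (\<lambda>i\<in>{..<m}. f (frob (r * i) \<alpha>))"

lemma inj_on_basis_values: "inj_on basis_values (ring_R \<phi> p r m)"
proof (rule inj_onI)
  fix f g assume "f \<in> ring_R \<phi> p r m" "g \<in> ring_R \<phi> p r m" "basis_values f = basis_values g"
  then show "f = g"
    by (intro R_eqI) (metis basis_values_def lessThan_iff restrict_apply')+
qed

lemma basis_values_in_PiE: "f \<in> ring_R \<phi> p r m \<Longrightarrow> basis_values f \<in> {..<m} \<rightarrow>\<^sub>E M"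
  by (auto simp: basis_values_def ring_R_iff End_kappa_iff M_frob \<alpha>_in_M)

lemma finite_R: "finite (ring_R \<phi> p r m)"
  by (rule inj_on_finite[OF inj_on_basis_values, of "{..<m} \<rightarrow>\<^sub>E M"])
    (simp_all add: image_subset_iff basis_values_in_PiE finite_PiE finite_M)

section \<open>Coordinates\<close>

definition combination ::
  "(nat \<Rightarrow> 'q alg_closure \<Rightarrow> 'q alg_closure) \<Rightarrow> (nat \<Rightarrow> 'q alg_closure) \<Rightarrow>
    'q alg_closure \<Rightarrow> 'q alg_closure" where
  "combination s b = (\<lambda>v. \<Sum>j=1..N. b j * s j v)"

lemma combination_diff:
  "combination s (\<lambda>j. b j - b' j) v = combination s b v - combination s b' v"
  by (simp add: combination_def left_diff_distrib sum_subtractf)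

lemma basis_in_S:
  assumes "Fq_basis (ring_S \<phi> p r) N s" "j \<in> {1..N}"
  shows "s j \<in> ring_S \<phi> p r"
  using assms endo.span_base[of "s j" "s ` {1..N}"] by (auto simp: Fq_basis_def)

lemma combination_in_R:
  assumes s: "Fq_basis (ring_S \<phi> p r) N s" and b: "\<And>j. j \<in> {1..N} \<Longrightarrow> b j \<in> L"
  shows "combination s b \<in> ring_R \<phi> p r m"
proof -
  have E: "s j \<in> End_kappa \<phi> p" if "j \<in> {1..N}" for j
    using S_subset_End basis_in_S[OF s that] .
  have fixed: "frob (r * m) (b j) = b j" if "j \<in> {1..N}" for j
    using subfield_Fq_mono[of m "r * m" "b j"] b[OF that] by (simp add: subfield_Fq_def)
  have 1: "combination s b v = 0" if "v \<notin> M" for v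
    unfolding combination_def using that E by (intro sum.neutral) (auto simp: End_kappa_iff)
  have 2: "combination s b v \<in> M" if "v \<in> M" for v
    unfolding combination_def using that E b by (intro M_sum M_L) (auto simp: End_kappa_iff)
  have 3: "combination s b (v + w) = combination s b v + combination s b w"
    if "v \<in> M" "w \<in> M" for v w
    unfolding combination_def sum.distrib[symmetric]
    using that E by (intro sum.cong) (auto simp: End_kappa_iff distrib_left)
  have 4: "combination s b (act a v) = act a (combination s b v)" if "v \<in> M" for a v
    unfolding combination_def act_sum
    using that E b by (intro sum.cong) (auto simp: End_kappa_iff act_L)
  have 5: "combination s b (frob (r * m) v) = frob (r * m) (combination s b v)" if "v \<in> M" for v
    unfolding combination_def frob_sum
    using that S_frob[OF basis_in_S[OF s]] fixed by (intro sum.cong) (auto simp: frob_mult)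
  show ?thesis
    using 1 2 3 4 5 by (simp add: ring_R_iff End_kappa_iff)
qed

text \<open>
  The rank \<open>w\<close> of the coefficients is the number of unknowns of a Moore system. The equations
  for \<open>i < w\<close> read \<open>\<Sum> \<beta> \<cdot> \<pi>\<^sup>i(x\<^sub>\<beta> \<alpha>) = 0\<close>, where the Frobenius sits on the unknown factor; applying
  \<open>\<pi>\<^bsup>w-1-i\<^esup>\<close> moves it to \<open>\<beta>\<close> and makes the unknowns \<open>\<pi>\<^bsup>w-1\<^esup>(x\<^sub>\<beta> \<alpha>)\<close> independent of \<open>i\<close>.
\<close>
lemma combination_vanishing:
  assumes s: "Fq_basis (ring_S \<phi> p r) N s" and b: "\<And>j. j \<in> {1..N} \<Longrightarrow> b j \<in> L"
    and vanish: "\<And>i. i < ac.dim (ac.span (b ` {1..N})) \<Longrightarrow> combination s b (frob (r * i) \<alpha>) = 0"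
    and j: "j \<in> {1..N}"
  shows "b j = 0"
proof -
  obtain B where B: "B \<subseteq> b ` {1..N}" "ac.independent B" "b ` {1..N} \<subseteq> ac.span B"
    "card B = ac.dim (b ` {1..N})"
    using ac.basis_exists by blast
  have fin_B: "finite B"
    using B(1) finite_subset by blast
  have B_L: "\<beta> \<in> L" if "\<beta> \<in> B" for \<beta>
    using that B(1) b by blast
  have "\<forall>j\<in>{1..N}. \<exists>c. b j = (\<Sum>\<beta>\<in>B. to_ac (c \<beta>) * \<beta>)"
    using B(3) by (auto simp: ac.span_finite[OF fin_B] scale_ac_def)
  then obtain c where c: "\<And>j. j \<in> {1..N} \<Longrightarrow> b j = (\<Sum>\<beta>\<in>B. to_ac (c j \<beta>) * \<beta>)"
    by metis
  define x where "x \<beta> = (\<Sum>j=1..N. scale_end (c j \<beta>) (s j))" for \<beta>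
  have x_S: "x \<beta> \<in> ring_S \<phi> p r" for \<beta>
    unfolding x_def
    using basis_in_S[OF s] subspace_S by (intro endo.subspace_sum endo.subspace_scale)
  have comb_eq: "combination s b v = (\<Sum>\<beta>\<in>B. \<beta> * x \<beta> v)" for v
  proof -
    have x_v: "x \<beta> v = (\<Sum>j=1..N. to_ac (c j \<beta>) * s j v)" for \<beta>
      by (simp add: x_def scale_end_def sum_apply)
    have "combination s b v = (\<Sum>j=1..N. \<Sum>\<beta>\<in>B. \<beta> * (to_ac (c j \<beta>) * s j v))"
      unfolding combination_def by (intro sum.cong) (auto simp: c sum_distrib_left sum_distrib_right mult_ac)
    also have "\<dots> = (\<Sum>\<beta>\<in>B. \<beta> * x \<beta> v)"
      by (subst sum.swap) (simp add: x_v sum_distrib_left)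
    finally show ?thesis .
  qed
  \<comment> \<open>The system below runs through \<open>i\<close> in reverse: its row \<open>i\<close> comes from vanishing at \<open>\<pi>\<^bsup>k-i\<^esup>\<alpha>\<close>.\<close>
  define k where "k = card B - 1"
  have x_\<alpha>: "frob (r * k) (x \<beta> \<alpha>) = 0" if "\<beta> \<in> B" for \<beta>
  proof (rule moore_system_trivial[OF fin_B coprime_m_r, where \<beta> = "\<lambda>\<beta>. \<beta>"
        and z = "\<lambda>\<beta>. frob (r * k) (x \<beta> \<alpha>)"])
    show "e \<beta> = 0" if "(\<Sum>\<beta>\<in>B. to_ac (e \<beta>) * \<beta>) = 0" "\<beta> \<in> B" for e \<beta>
      using independent_imp_coeff_0[OF fin_B B(2) that] .
    fix i assume i: "i < card B"
    then have "k - i < card B"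
      by (auto simp: k_def)
    then have "0 = (\<Sum>\<beta>\<in>B. \<beta> * x \<beta> (frob (r * (k - i)) \<alpha>))"
      using vanish[of "k - i"] B(4) by (simp add: comb_eq)
    then have "0 = frob (r * i) (\<Sum>\<beta>\<in>B. \<beta> * x \<beta> (frob (r * (k - i)) \<alpha>))"
      by (metis frob_0)
    also have "\<dots> = (\<Sum>\<beta>\<in>B. frob (r * i) \<beta> * frob (r * k) (x \<beta> \<alpha>))"
      using i by (simp add: k_def frob_sum frob_mult S_frob[OF x_S \<alpha>_in_M] frob_frob
          flip: distrib_left)
    finally show "(\<Sum>\<beta>\<in>B. frob (r * i) \<beta> * frob (r * k) (x \<beta> \<alpha>)) = 0"
      by (rule sym)
  qed (use that B_L in auto)
  have "c j \<beta> = 0" if "\<beta> \<in> B" for \<beta>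
  proof -
    have x_0: "x \<beta> = 0"
      using x_\<alpha>[OF that] bij_betw_S_M endo.subspace_0[OF subspace_S] x_S
      by (auto simp: bij_betw_def inj_on_def)
    have inj: "inj_on s {1..N}"
      using s by (simp add: Fq_basis_def)
    \<comment> \<open>The coefficient of a basis element, indexed by the element instead of its number.\<close>
    define u where "u y = c (the_inv_into {1..N} s y) \<beta>" for y
    have "(\<Sum>y\<in>s ` {1..N}. scale_end (u y) y) = x \<beta>"
      unfolding x_def sum.reindex[OF inj]
      by (intro sum.cong) (simp_all add: u_def the_inv_into_f_f[OF inj] del: One_nat_def)
    then have "(\<Sum>y\<in>s ` {1..N}. scale_end (u y) y) = 0"
      by (simp only: x_0)
    then have "endo.dependent (s ` {1..N})" if "u (s j) \<noteq> 0"
      unfolding endo.dependent_finite[OF finite_imageI[OF finite_atLeastAtMost]]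
      using that j by (intro exI[of _ u] conjI bexI[of _ "s j"] imageI)
    then have "u (s j) = 0"
      using s by (auto simp: Fq_basis_def)
    then show ?thesis
      using j by (simp add: u_def the_inv_into_f_f[OF inj] del: One_nat_def)
  qed
  then show ?thesis
    by (simp add: c[OF j])
qed

lemma combination_inj:
  assumes s: "Fq_basis (ring_S \<phi> p r) N s"
    and b: "\<And>j. j \<in> {1..N} \<Longrightarrow> b j \<in> L" and b': "\<And>j. j \<in> {1..N} \<Longrightarrow> b' j \<in> L"
    and eq: "\<And>i. i < ac.dim (ac.span ((\<lambda>j. b j - b' j) ` {1..N})) \<Longrightarrow>
      combination s b (frob (r * i) \<alpha>) = combination s b' (frob (r * i) \<alpha>)"
    and j: "j \<in> {1..N}"
  shows "b j = b' j"
proof -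
  have "b j - b' j = 0"
    by (rule combination_vanishing[OF s _ _ j])
      (use b b' eq in \<open>auto simp: combination_diff intro: subfield_Fq_closed\<close>)
  then show ?thesis
    by simp
qed

text \<open>
  The two injections compose to an injection \<open>L\<^sup>N \<rightarrow> M\<^sup>m\<close> between sets of the same size, so neither
  step can fail to be surjective.
\<close>
lemma bij_betw_combination:
  assumes s: "Fq_basis (ring_S \<phi> p r) N s"
  shows "bij_betw (combination s) ({1..N} \<rightarrow>\<^sub>E L) (ring_R \<phi> p r m)"
    and bij_betw_basis_values: "bij_betw basis_values (ring_R \<phi> p r m) ({..<m} \<rightarrow>\<^sub>E M)"
proof -
  have inj: "inj_on (combination s) ({1..N} \<rightarrow>\<^sub>E L)"
  proof (rule inj_onI)
    fix b b' assume b: "b \<in> {1..N} \<rightarrow>\<^sub>E L" "b' \<in> {1..N} \<rightarrow>\<^sub>E L"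
      and eq: "combination s b = combination s b'"
    have "b j = b' j" if "j \<in> {1..N}" for j
      by (rule combination_inj[OF s _ _ _ that]) (use b eq in auto)
    then show "b = b'"
      using b by (intro PiE_ext[of b "{1..N}" _ b']) auto
  qed
  have sub: "combination s ` ({1..N} \<rightarrow>\<^sub>E L) \<subseteq> ring_R \<phi> p r m"
    using combination_in_R[OF s] by blast
  have sub': "basis_values ` ring_R \<phi> p r m \<subseteq> {..<m} \<rightarrow>\<^sub>E M"
    using basis_values_in_PiE by blast
  have fin: "finite ({..<m} \<rightarrow>\<^sub>E M)"
    by (simp add: finite_PiE finite_M)
  have card_eq: "card ({1..N} \<rightarrow>\<^sub>E L) = card ({..<m} \<rightarrow>\<^sub>E M)"
    by (simp add: card_PiE card_subfield_Fq(1)[OF m_pos] card_M mult.commute flip: power_mult)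
  have le: "card ({1..N} \<rightarrow>\<^sub>E L) \<le> card (ring_R \<phi> p r m)"
    using card_inj_on_le[OF inj sub finite_R] .
  have le': "card (ring_R \<phi> p r m) \<le> card ({..<m} \<rightarrow>\<^sub>E M)"
    using card_inj_on_le[OF inj_on_basis_values sub' fin] .
  have "combination s ` ({1..N} \<rightarrow>\<^sub>E L) = ring_R \<phi> p r m"
    by (rule card_subset_eq[OF finite_R sub]) (use le le' card_eq card_image[OF inj] in simp)
  then show "bij_betw (combination s) ({1..N} \<rightarrow>\<^sub>E L) (ring_R \<phi> p r m)"
    using inj by (rule bij_betw_imageI[rotated])
  have "basis_values ` ring_R \<phi> p r m = {..<m} \<rightarrow>\<^sub>E M"
    by (rule card_subset_eq[OF fin sub'])
      (use le le' card_eq card_image[OF inj_on_basis_values] in simp)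
  then show "bij_betw basis_values (ring_R \<phi> p r m) ({..<m} \<rightarrow>\<^sub>E M)"
    using inj_on_basis_values by (rule bij_betw_imageI[rotated])
qed

section \<open>The code\<close>

text \<open>Elements of \<open>R\<close> commute with \<open>R\<^sub>0\<close>, so it is enough to test the generators of \<open>W\<^sub>\<delta>\<close>.\<close>
lemma rank_BCH_iff:
  "f \<in> rank_BCH \<phi> p r m \<alpha> \<delta> \<longleftrightarrow>
    f \<in> ring_R \<phi> p r m \<and> (\<forall>i<\<delta> - 1. f (frob (r * i) \<alpha>) = 0)"
proof (intro iffI conjI allI impI)
  assume f: "f \<in> rank_BCH \<phi> p r m \<alpha> \<delta>"
  then show "f \<in> ring_R \<phi> p r m"
    by (simp add: rank_BCH_def Ann_R_def)
  fix i assume i: "i < \<delta> - 1"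
  \<comment> \<open>\<open>\<rho> j\<close> is the identity of \<open>M\<close> for \<open>j = i\<close> and zero (an empty sum) otherwise.\<close>
  define \<rho> where "\<rho> j = skew_sum m (if j = i then 1 else 0) (\<lambda>_. 1)" for j
  have "\<rho> j (frob (r * j) \<alpha>) = (if j = i then frob (r * j) \<alpha> else 0)" for j
    by (simp add: \<rho>_def skew_sum_def M_frob \<alpha>_in_M)
  then have "frob (r * i) \<alpha> = (\<Sum>j<\<delta> - 1. \<rho> j (frob (r * j) \<alpha>))"
    using i by simp
  moreover have "\<forall>j<\<delta> - 1. \<rho> j \<in> ring_R0 \<phi> p r m"
    by (auto simp: \<rho>_def ring_R0_eq)
  ultimately have "frob (r * i) \<alpha> \<in> W_space \<phi> p r m \<alpha> \<delta>"
    unfolding W_space_def by blast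
  then show "f (frob (r * i) \<alpha>) = 0"
    using f by (simp add: rank_BCH_def Ann_R_def)
next
  assume f: "f \<in> ring_R \<phi> p r m \<and> (\<forall>i<\<delta> - 1. f (frob (r * i) \<alpha>) = 0)"
  have "f w = 0" if w_W: "w \<in> W_space \<phi> p r m \<alpha> \<delta>" for w
  proof -
    obtain \<rho> where w: "w = (\<Sum>i<\<delta> - 1. \<rho> i (frob (r * i) \<alpha>))"
      and \<rho>: "\<And>i. i < \<delta> - 1 \<Longrightarrow> \<rho> i \<in> ring_R0 \<phi> p r m"
      using w_W unfolding W_space_def by blast
    have \<rho>_End: "\<rho> i \<in> End_kappa \<phi> p" if "i < \<delta> - 1" for i
      using \<rho>[OF that] by (auto simp: ring_R0_eq skew_sum_End)
    have "f w = (\<Sum>i<\<delta> - 1. f (\<rho> i (frob (r * i) \<alpha>)))"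
      unfolding w using f \<rho>_End M_frob[OF \<alpha>_in_M]
      by (intro End_kappa_sum) (auto simp: ring_R_def End_kappa_iff)
    also have "\<dots> = (\<Sum>i<\<delta> - 1. \<rho> i (f (frob (r * i) \<alpha>)))"
    proof (intro sum.cong refl)
      fix i assume "i \<in> {..<\<delta> - 1}"
      then have "f \<circ> \<rho> i = \<rho> i \<circ> f"
        using f \<rho> by (simp add: ring_R_def)
      then show "f (\<rho> i (frob (r * i) \<alpha>)) = \<rho> i (f (frob (r * i) \<alpha>))"
        by (metis comp_apply)
    qed
    also have "\<dots> = 0"
      using f \<rho>_End End_kappa_sum[of _ "{}"] by (intro sum.neutral) auto
    finally show ?thesis .
  qed
  then show "f \<in> rank_BCH \<phi> p r m \<alpha> \<delta>"
    using f by (simp add: rank_BCH_def Ann_R_def)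
qed

lemma subspace_rank_BCH: "endo.subspace (rank_BCH \<phi> p r m \<alpha> \<delta>)"
proof (rule endo.subspaceI)
  show "0 \<in> rank_BCH \<phi> p r m \<alpha> \<delta>"
    using endo.subspace_0[OF subspace_R] by (simp add: rank_BCH_iff)
next
  fix f g assume "f \<in> rank_BCH \<phi> p r m \<alpha> \<delta>" "g \<in> rank_BCH \<phi> p r m \<alpha> \<delta>"
  then show "f + g \<in> rank_BCH \<phi> p r m \<alpha> \<delta>"
    using endo.subspace_add[OF subspace_R] by (simp add: rank_BCH_iff)
next
  fix c f assume "f \<in> rank_BCH \<phi> p r m \<alpha> \<delta>"
  then show "scale_end c f \<in> rank_BCH \<phi> p r m \<alpha> \<delta>"
    using endo.subspace_scale[OF subspace_R, of f c] by (auto simp: rank_BCH_iff scale_end_def)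
qed

lemma finite_rank_BCH: "finite (rank_BCH \<phi> p r m \<alpha> \<delta>)"
  by (rule finite_subset[OF _ finite_R]) (auto simp: rank_BCH_iff)

text \<open>
  Under \<open>basis_values\<close> the code becomes the set of all tuples in \<open>M\<^sup>m\<close> that start with \<open>\<delta> - 1\<close> zeros,
  leaving \<open>m - \<delta> + 1\<close> free entries with \<open>q\<^sup>N\<close> choices each.
\<close>
lemma dim_rank_BCH:
  assumes "1 \<le> \<delta>" "\<delta> \<le> m"
  shows "endo.dim (rank_BCH \<phi> p r m \<alpha> \<delta>) = N * (m - \<delta> + 1)"
proof (rule dim_eqI_card[OF vector_space_scale_end subspace_rank_BCH finite_rank_BCH])
  let ?C = "rank_BCH \<phi> p r m \<alpha> \<delta>"
  let ?V = "\<lambda>i. if i < \<delta> - 1 then {0} else M"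
  have bij: "bij_betw basis_values (ring_R \<phi> p r m) ({..<m} \<rightarrow>\<^sub>E M)"
    using ex_basis_S bij_betw_basis_values by blast
  have "basis_values ` ?C = (\<Pi>\<^sub>E i\<in>{..<m}. ?V i)"
  proof (intro equalityI subsetI)
    fix g assume "g \<in> basis_values ` ?C"
    then obtain f where f: "f \<in> ?C" "g = basis_values f"
      by blast
    then have "basis_values f \<in> {..<m} \<rightarrow>\<^sub>E M"
      by (simp add: rank_BCH_iff basis_values_in_PiE)
    then show "g \<in> (\<Pi>\<^sub>E i\<in>{..<m}. ?V i)"
      using f assms by (auto simp: rank_BCH_iff basis_values_def PiE_iff)
  next
    fix g assume g: "g \<in> (\<Pi>\<^sub>E i\<in>{..<m}. ?V i)"
    have "g i \<in> M" if "i < m" for i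
      using PiE_mem[OF g, of i] that by (simp split: if_splits)
    then have "g \<in> {..<m} \<rightarrow>\<^sub>E M"
      using g by (simp add: PiE_iff)
    then have "g \<in> basis_values ` ring_R \<phi> p r m"
      by (simp only: bij_betw_imp_surj_on[OF bij])
    then obtain f where f: "f \<in> ring_R \<phi> p r m" "g = basis_values f"
      by blast
    have "f (frob (r * i) \<alpha>) = 0" if "i < \<delta> - 1" for i
    proof -
      have "g i = 0"
        using PiE_mem[OF g, of i] that assms by simp
      then show ?thesis
        using that assms by (simp add: f basis_values_def split: if_splits)
    qed
    then show "g \<in> basis_values ` ?C"
      using f by (auto simp: rank_BCH_iff)
  qed
  moreover have "inj_on basis_values ?C"
    using inj_on_basis_values by (rule inj_on_subset) (auto simp: rank_BCH_iff)
  ultimately have "card ?C = (\<Prod>i<m. card (?V i))"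
    using card_image[of basis_values ?C] by (simp add: card_PiE)
  also have "\<dots> = (\<Prod>i\<in>{\<delta> - 1..<m}. card M)"
    by (intro prod.mono_neutral_cong_right) (use assms in auto)
  also have "\<dots> = CARD('q) ^ (N * (m - \<delta> + 1))"
    using assms by (simp add: card_M Suc_diff_le power_add flip: power_mult)
  finally show "card ?C = CARD('q) ^ (N * (m - \<delta> + 1))" .
qed

lemma rank_coeffs_combination:
  assumes s: "Fq_basis (ring_S \<phi> p r) N s" and b: "b \<in> {1..N} \<rightarrow>\<^sub>E L"
  shows "rank_coeffs m N s (combination s b) = b"
  unfolding rank_coeffs_def
proof (rule the_equality)
  fix b' assume "b' \<in> {1..N} \<rightarrow>\<^sub>E L \<and> combination s b = (\<lambda>v. \<Sum>j=1..N. b' j * s j v)"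
  then show "b' = b"
    using b bij_betw_imp_inj_on[OF bij_betw_combination(1)[OF s]]
    by (auto simp: combination_def inj_on_def)
qed (use b in \<open>simp add: combination_def\<close>)

lemma rank_wt_combination:
  assumes "Fq_basis (ring_S \<phi> p r) N s" "b \<in> {1..N} \<rightarrow>\<^sub>E L"
  shows "rank_wt m N s (combination s b) = ac.dim (ac.span (b ` {1..N}))"
  using rank_coeffs_combination[OF assms] by (simp add: rank_wt_def)

lemma combination_0: "(\<And>j. j \<in> {1..N} \<Longrightarrow> b j = 0) \<Longrightarrow> combination s b = 0"
  by (simp add: combination_def fun_eq_iff)

lemma rank_wt_ge:
  assumes s: "Fq_basis (ring_S \<phi> p r) N s"
    and f: "f \<in> rank_BCH \<phi> p r m \<alpha> \<delta>" "f \<noteq> 0"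
  shows "\<delta> \<le> rank_wt m N s f"
proof (rule ccontr)
  assume less: "\<not> \<delta> \<le> rank_wt m N s f"
  have "f \<in> combination s ` ({1..N} \<rightarrow>\<^sub>E L)"
    using f(1) bij_betw_imp_surj_on[OF bij_betw_combination(1)[OF s]]
    by (simp only: rank_BCH_iff)
  then obtain b where b: "b \<in> {1..N} \<rightarrow>\<^sub>E L" "f = combination s b"
    by blast
  have "b j = 0" if "j \<in> {1..N}" for j
  proof (rule combination_vanishing[OF s _ _ that])
    fix i assume "i < ac.dim (ac.span (b ` {1..N}))"
    then have "i < \<delta> - 1"
      using less rank_wt_combination[OF s b(1)] b(2) by simp
    then show "combination s b (frob (r * i) \<alpha>) = 0"
      using f(1) b(2) by (simp add: rank_BCH_iff)
  qed (use b in auto)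
  then show False
    using combination_0 f(2) b(2) by blast
qed

lemma ex_subspace_L:
  assumes "k \<le> m"
  obtains V where "ac.subspace V" "V \<subseteq> L" "ac.dim V = k" "card V = CARD('q) ^ k" "finite V"
proof -
  note L = card_subfield_Fq[OF m_pos, where 'q = 'q]
  have dim_L: "ac.dim L = m"
    by (rule dim_eqI_card[OF vector_space_scale_ac subspace_subfield_Fq L(2,1)])
  obtain B where B: "B \<subseteq> L" "ac.independent B" "L \<subseteq> ac.span B" "card B = ac.dim L"
    by (rule ac.basis_exists)
  then have "k \<le> card B"
    using assms dim_L by simp
  then obtain B' where B': "B' \<subseteq> B" "card B' = k" "finite B'"
    by (rule obtain_subset_with_card_n)
  then have indep: "ac.independent B'"
    using B(2) ac.independent_mono by blast
  have "ac.span B' \<subseteq> L"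
    using B B' by (intro ac.span_minimal subspace_subfield_Fq) auto
  then show thesis
    using card_span_independent[OF vector_space_scale_ac B'(3) indep] B' indep L(2)
      ac.dim_span_eq_card_independent[OF indep] ac.subspace_span finite_subset
    by (intro that[of "ac.span B'"]) auto
qed

text \<open>
  A pigeonhole argument: coefficient families with values in a \<open>\<delta>\<close>-dimensional space \<open>V\<close> outnumber
  the possible values of \<open>f\<close> at the \<open>\<delta> - 1\<close> points \<open>\<pi>\<^sup>i\<alpha>\<close>, \<open>i < \<delta> - 1\<close>.
\<close>
lemma ex_rank_wt_le:
  assumes s: "Fq_basis (ring_S \<phi> p r) N s" and "1 \<le> \<delta>" "\<delta> \<le> m"
  obtains f where "f \<in> rank_BCH \<phi> p r m \<alpha> \<delta>" "f \<noteq> 0" "rank_wt m N s f \<le> \<delta>"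
proof -
  obtain V where V: "ac.subspace V" "V \<subseteq> L" "ac.dim V = \<delta>" "card V = CARD('q) ^ \<delta>" "finite V"
    using ex_subspace_L[OF assms(3)] by blast
  define h where "h b = (\<lambda>i\<in>{..<\<delta> - 1}. combination s b (frob (r * i) \<alpha>))" for b
  have h_in: "h ` ({1..N} \<rightarrow>\<^sub>E V) \<subseteq> {..<\<delta> - 1} \<rightarrow>\<^sub>E M"
  proof (rule image_subsetI)
    fix b assume "b \<in> {1..N} \<rightarrow>\<^sub>E V"
    then have "combination s b \<in> ring_R \<phi> p r m"
      using V(2) by (intro combination_in_R[OF s]) auto
    then show "h b \<in> {..<\<delta> - 1} \<rightarrow>\<^sub>E M"
      by (auto simp: h_def ring_R_iff End_kappa_iff M_frob \<alpha>_in_M)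
  qed
  have "N \<ge> 1"
    using n_pos degree_p by simp
  then have "card M ^ (\<delta> - 1) < card V ^ N"
    using assms(2) CARD_field_gt_1[where 'q = 'q]
    by (simp add: card_M V(4) flip: power_mult)
  then have "card ({..<\<delta> - 1} \<rightarrow>\<^sub>E M) < card ({1..N} \<rightarrow>\<^sub>E V)"
    by (simp add: card_PiE)
  then have "\<not> inj_on h ({1..N} \<rightarrow>\<^sub>E V)"
    using card_inj_on_le[OF _ h_in] finite_M by (auto simp: finite_PiE)
  then obtain b b' where b: "b \<in> {1..N} \<rightarrow>\<^sub>E V" "b' \<in> {1..N} \<rightarrow>\<^sub>E V" "h b = h b'" "b \<noteq> b'"
    by (auto simp: inj_on_def)
  define e where "e = (\<lambda>j\<in>{1..N}. b j - b' j)"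
  have e_V: "e j \<in> V" if "j \<in> {1..N}" for j
    using PiE_mem[OF b(1) that] PiE_mem[OF b(2) that] that ac.subspace_diff[OF V(1)]
    by (simp add: e_def)
  then have e_L: "e \<in> {1..N} \<rightarrow>\<^sub>E L"
    using V(2) by (auto simp: e_def)
  have comb_e: "combination s e v = combination s b v - combination s b' v" for v
    by (simp add: combination_def e_def left_diff_distrib sum_subtractf)
  show thesis
  proof (rule that)
    have "combination s e (frob (r * i) \<alpha>) = 0" if "i < \<delta> - 1" for i
    proof -
      have "h b i = h b' i"
        using b(3) by simp
      then show ?thesis
        using that by (simp add: comb_e h_def)
    qed
    then show "combination s e \<in> rank_BCH \<phi> p r m \<alpha> \<delta>"
      using e_L by (auto simp: rank_BCH_iff intro!: combination_in_R[OF s])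
    show "combination s e \<noteq> 0"
    proof
      assume "combination s e = 0"
      then have "combination s b = combination s b'"
        using comb_e by (simp add: fun_eq_iff)
      moreover have "b \<in> {1..N} \<rightarrow>\<^sub>E L" "b' \<in> {1..N} \<rightarrow>\<^sub>E L"
        using b V(2) by auto
      ultimately show False
        using b(4) bij_betw_imp_inj_on[OF bij_betw_combination(1)[OF s]]
        by (auto simp: inj_on_def)
    qed
    have "ac.span (e ` {1..N}) \<subseteq> V"
      using e_V by (intro ac.span_minimal V) auto
    then have "CARD('q) ^ ac.dim (ac.span (e ` {1..N})) \<le> CARD('q) ^ \<delta>"
      using V card_mono[of V] finite_subset
        card_eq_power_dim[OF vector_space_scale_ac ac.subspace_span, of "e ` {1..N}"]
      by metis
    then show "rank_wt m N s (combination s e) \<le> \<delta>"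
      using rank_wt_combination[OF s e_L] CARD_field_gt_1[where 'q = 'q] by simp
  qed
qed

lemma min_rank_dist_rank_BCH:
  assumes s: "Fq_basis (ring_S \<phi> p r) N s" and "1 \<le> \<delta>" "\<delta> \<le> m"
  shows "min_rank_dist m N s (rank_BCH \<phi> p r m \<alpha> \<delta>) = \<delta>"
  unfolding min_rank_dist_def
proof (rule Min_eqI)
  show "finite (rank_wt m N s ` (rank_BCH \<phi> p r m \<alpha> \<delta> - {0}))"
    by (simp add: finite_rank_BCH)
  show "\<delta> \<le> w" if "w \<in> rank_wt m N s ` (rank_BCH \<phi> p r m \<alpha> \<delta> - {0})" for w
    using that rank_wt_ge[OF s] by auto
  obtain f where f: "f \<in> rank_BCH \<phi> p r m \<alpha> \<delta>" "f \<noteq> 0" "rank_wt m N s f \<le> \<delta>"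
    using ex_rank_wt_le[OF assms] by blast
  then have "rank_wt m N s f = \<delta>"
    using rank_wt_ge[OF s f(1,2)] by simp
  then show "\<delta> \<in> rank_wt m N s ` (rank_BCH \<phi> p r m \<alpha> \<delta> - {0})"
    using f by blast
qed

end

theorem theorem5p9:
  fixes p\<^sub>0 p :: "'q::{field,finite} poly"
    and \<phi> :: "'q poly \<Rightarrow> 'q alg_closure poly"
    and t \<alpha> :: "'q alg_closure"
    and n r d m \<delta> :: nat
  assumes "n \<ge> 1"
    and "irreducible p\<^sub>0" and "lead_coeff p\<^sub>0 = 1" and "degree p\<^sub>0 = r"
    and "coprime n r"
    and "t \<in> subfield_Fq r" and "poly (map_poly to_ac p\<^sub>0) t = 0"
    and "tw_algebra_hom r \<phi>" and "\<phi> [:0, 1:] = [:t:] + monom 1 n"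
    and "irreducible p" and "lead_coeff p = 1" and "p \<noteq> p\<^sub>0" and "degree p = d"
    and "m dvd n"
    and "S_normal \<phi> p r n \<alpha>"
    and "1 \<le> \<delta>" and "\<delta> \<le> m"
  shows "vector_space.dim scale_end (rank_BCH \<phi> p r m \<alpha> \<delta>) = n * d * (m - \<delta> + 1) \<and>
    (\<forall>s. Fq_basis (ring_S \<phi> p r) (n * d) s \<longrightarrow>
       min_rank_dist m (n * d) s (rank_BCH \<phi> p r m \<alpha> \<delta>) = \<delta>)"
proof -
  have "p \<noteq> 0" "\<not> is_unit p"
    using \<open>irreducible p\<close> by (auto simp: irreducible_def)
  then have "degree p \<ge> 1"
    using is_unit_iff_degree[of p] by simp
  then interpret normal_torsion \<phi> p t \<alpha> r n m
    using assms by unfold_locales auto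
  show ?thesis
    using dim_rank_BCH min_rank_dist_rank_BCH \<open>degree p = d\<close> \<open>1 \<le> \<delta>\<close> \<open>\<delta> \<le> m\<close> by blast
qed

end
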